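(* Consider an internally consistent IMEX-MRI-GARK method with coefficients $c^{\{S\}}$, $\Gamma^{\{k\}}$, $\Omega^{\{k\}}$ ($k=0,\dots,k_{\max}$), base IMEX-ARK matrices $A^{\{I,I\}},A^{\{E,E\}}$, and fast Runge–Kutta method $(A^{\{F,F\}},b^{\{F\}},c^{\{F\}})$ of order at least three, as described in the context. The IMEX-MRI-GARK method has order three if and only if the base IMEX-ARK method has order at least three and the coupling conditions $$\Delta c^{\{S\}T}\mathcal{A}^{\{I,\zeta\}}c^{\{S\}}=\frac16\qquad\text{and}\qquad \Delta c^{\{S\}T}\mathcal{A}^{\{E,\zeta\}}c^{\{S\}}=\frac16$$ hold, where $$\mathcal{A}^{\{I,\zeta\}}=LA^{\{I,I\}}+\sum_{k=0}^{k_{\max}}\zeta_k\Gamma^{\{k\}},\qquad \mathcal{A}^{\{E,\zeta\}}=LA^{\{E,E\}}+\sum_{k=0}^{k_{\max}}\zeta_k\Omega^{\{k\}},\qquad \zeta_k=b^{\{F\}T}A^{\{F,F\}}c^{\{F\}\times k}.$$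
   Context: Problem: $y'=f^{\{I\}}(t,y)+f^{\{E\}}(t,y)+f^{\{F\}}(t,y)$, $y(t_0)=y_0$ (slow implicit, slow explicit and fast parts). IMEX-MRI-GARK method. Data: $c^{\{S\}}\in\mathbb{R}^{s^{\{S\}}}$ with $c^{\{S\}}_1=0$; $\Delta c^{\{S\}}\in\mathbb{R}^{s^{\{S\}}}$ with $\Delta c^{\{S\}}_1=0$ and $\Delta c^{\{S\}}_i=c^{\{S\}}_i-c^{\{S\}}_{i-1}\ge 0$ for $i=2,\dots,s^{\{S\}}$; for $k=0,\dots,k_{\max}$, lower triangular $\Gamma^{\{k\}}=(\gamma^{\{k\}}_{i,j})$ and strictly lower triangular $\Omega^{\{k\}}=(\omega^{\{k\}}_{i,j})$ in $\mathbb{R}^{s^{\{S\}}\times s^{\{S\}}}$, each with zero first row. Put $\gamma_{i,j}(\tau)=\sum_{k=0}^{k_{\max}}\gamma_{i,j}^{\{k\}}\tau^k$, $\omega_{i,j}(\tau)=\sum_{k=0}^{k_{\max}}\omega_{i,j}^{\{k\}}\tau^k$. One step of size $H$ from $t_n$: $Y_1^{\{S\}}=y_n$; for $i=2,\dots,s^{\{S\}}$ let $v(0)=Y^{\{S\}}_{i-1}$, $T_{i-1}=t_n+c^{\{S\}}_{i-1}H$, solve on $\theta\in[0,H]$ $$v'(\theta)=\Delta c_i^{\{S\}}f^{\{F\}}\big(T_{i-1}+\Delta c_i^{\{S\}}\theta,v(\theta)\big)+\sum_{j=1}^{i}\gamma_{i,j}(\theta/H)f^{\{I\}}_j+\sum_{j=1}^{i-1}\omega_{i,j}(\theta/H)f^{\{E\}}_j,$$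 and set $Y_i^{\{S\}}=v(H)$, where $f^{\{\sigma\}}_j=f^{\{\sigma\}}(t_n+c^{\{S\}}_jH,Y^{\{S\}}_j)$ for $\sigma\in\{I,E\}$; finally $y_{n+1}=Y^{\{S\}}_{s^{\{S\}}}$. Base IMEX-ARK method. Let $\overline\Gamma=\sum_{k}\frac{1}{k+1}\Gamma^{\{k\}}$, $\overline\Omega=\sum_k\frac1{k+1}\Omega^{\{k\}}$, and $E\in\mathbb{R}^{s^{\{S\}}\times s^{\{S\}}}$ with $E_{i,j}=1$ for $i\ge j$ and $0$ otherwise. The base method is the additive Runge–Kutta method $Y_i=y_n+H\sum_j a^{\{I,I\}}_{i,j}f^{\{I\}}(t_n+c^{\{S\}}_jH,Y_j)+H\sum_j a^{\{E,E\}}_{i,j}f^{\{E\}}(t_n+c^{\{S\}}_jH,Y_j)$, $y_{n+1}=Y_{s^{\{S\}}}$, for $y'=f^{\{I\}}+f^{\{E\}}$, with $A^{\{I,I\}}=E\overline\Gamma$, $A^{\{E,E\}}=E\overline\Omega$. It is stiffly accurate: its weights $b^{\{I\}},b^{\{E\}}$ are the last rows of $A^{\{I,I\}},A^{\{E,E\}}$. It is assumed internally consistent: $A^{\{I,I\}}\mathbb{1}^{\{S\}}=A^{\{E,E\}}\mathbb{1}^{\{S\}}=c^{\{S\}}$. Fast method. Each fast initial-value problem is solved with a single step (of size $H$ in $\theta$) of a fixed $s^{\{F\}}$-stage Runge–Kutta method $(A^{\{F,F\}},b^{\{F\}},c^{\{F\}})$ with $A^{\{F,F\}}\mathbb{1}^{\{F\}}=c^{\{F\}}$,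 whose order is at least that considered for the IMEX-MRI-GARK method (here three), and with $b^{\{F\}T}c^{\{F\}\times k}=\frac1{k+1}$ for $k=0,\dots,k_{\max}$. Explicitly, for $i=2,\dots,s^{\{S\}}$ and $p=1,\dots,s^{\{F\}}$, with $f^{\{F,i\}}_l=f^{\{F\}}(T_{i-1}+c^{\{F\}}_l\Delta c^{\{S\}}_iH,Y^{\{F,i\}}_l)$, $$Y^{\{F,i\}}_p=Y^{\{S\}}_{i-1}+H\sum_{l}a^{\{F,F\}}_{p,l}\Big(\Delta c^{\{S\}}_if^{\{F,i\}}_l+\sum_{j\le i}\gamma_{i,j}(c^{\{F\}}_l)f^{\{I\}}_j+\sum_{j<i}\omega_{i,j}(c^{\{F\}}_l)f^{\{E\}}_j\Big),$$ and $Y^{\{S\}}_i$ is given by the same formula with $a^{\{F,F\}}_{p,l}$ replaced by $b^{\{F\}}_l$. This fully discrete scheme is a three-partition ($I,E,F$) generalized-structure additive Runge–Kutta (GARK) method. Internally consistent means $\Gamma^{\{0\}}\mathbb{1}^{\{S\}}=\Omega^{\{0\}}\mathbb{1}^{\{S\}}=\Delta c^{\{S\}}$ and $\Gamma^{\{k\}}\mathbb{1}^{\{S\}}=\Omega^{\{k\}}\mathbb{1}^{\{S\}}=0$ for all $k\ge1$. Order. A one-step method for an additively split problem has order $p$ (meaning at least $p$) if its local error after one step of size $H$ is $O(H^{p+1})$ for all sufficiently smooth right-hand-side components; equivalently, all (additive Runge–Kutta / GARK) order conditions up to order $p$ hold. The order of the IMEX-MRI-GARK method is that of the fully discrete scheme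 above. Notation. $\mathbb{1}^{\{S\}},\mathbb{1}^{\{F\}}$ are vectors of ones in $\mathbb{R}^{s^{\{S\}}},\mathbb{R}^{s^{\{F\}}}$; $c^{\times k}$ is the element-wise power ($c^{\times0}$ is the vector of ones); $L\in\mathbb{R}^{s^{\{S\}}\times s^{\{S\}}}$, $L_{i,j}=\delta_{i,j+1}$. *)

theory Defs
  imports "HOL-Analysis.Analysis" "HOL-Library.Landau_Symbols"
begin

(* Vectors in R^s and s x s matrices are functions on nat that are only inspected at the
   indices 1..s (1-based, as is usual for Runge-Kutta tableaux). *)

definition mat_mult :: "nat \<Rightarrow> (nat \<Rightarrow> nat \<Rightarrow> real) \<Rightarrow> (nat \<Rightarrow> nat \<Rightarrow> real) \<Rightarrow> nat \<Rightarrow> nat \<Rightarrow> real" where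
  "mat_mult s A B i j = (\<Sum>k=1..s. A i k * B k j)"

definition mat_vec :: "nat \<Rightarrow> (nat \<Rightarrow> nat \<Rightarrow> real) \<Rightarrow> (nat \<Rightarrow> real) \<Rightarrow> nat \<Rightarrow> real" where
  "mat_vec s A x i = (\<Sum>j=1..s. A i j * x j)"

definition dot :: "nat \<Rightarrow> (nat \<Rightarrow> real) \<Rightarrow> (nat \<Rightarrow> real) \<Rightarrow> real" where
  "dot s x y = (\<Sum>i=1..s. x i * y i)"


(* Multivariate C^k: every directional derivative of order up to k exists, with Frechet
   differentiability at each stage below k and continuity at stage k. *)
primrec C_k :: "nat \<Rightarrow> ('b::real_normed_vector \<Rightarrow> 'c::real_normed_vector) \<Rightarrow> bool" where
  "C_k 0 g \<longleftrightarrow> continuous_on UNIV g"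
| "C_k (Suc k) g \<longleftrightarrow>
     (\<forall>x. g differentiable (at x)) \<and> (\<forall>v. C_k k (\<lambda>x. frechet_derivative g (at x) v))"

datatype component = Impl | Expl | Fast

(* A one-step scheme is a relation "step f t0 y0 H Y y1": one step of size H from (t0, y0)
   for the right-hand side components f produces y1, with Y satisfying the (possibly implicit)
   stage equations. P is the set of components present in the problem, S the set of stage
   indices. The scheme has order (at least) p if its local error is O(H^(p+1)) for all
   sufficiently smooth (i.e. C^k for some large enough k) components.
   For implicit schemes the stage equations can have spurious solutions far from y0; the
   numerical solution is the one whose stages tend to y0 as H tends to 0 (it exists for small H by the
   implicit function theorem). The state space 'a is an arbitrary Euclidean space. *)
definition has_order ::
  "component set \<Rightarrow> 'i set \<Rightarrow>
   ((component \<Rightarrow> real \<Rightarrow> 'a \<Rightarrow> 'a) \<Rightarrow> real \<Rightarrow> 'a \<Rightarrow> real \<Rightarrow> ('i \<Rightarrow> 'a) \<Rightarrow> 'a \<Rightarrow> bool) \<Rightarrow>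
   nat \<Rightarrow> ('a::euclidean_space) itself \<Rightarrow> bool" where
  "has_order P S step p _ \<longleftrightarrow>
    (\<exists>k. \<forall>(f :: component \<Rightarrow> real \<Rightarrow> 'a \<Rightarrow> 'a) t0 y0 \<delta> y Y y1.
       (\<forall>\<sigma>\<in>P. C_k k (\<lambda>(t, x). f \<sigma> t x)) \<longrightarrow>
       \<delta> > 0 \<longrightarrow> y t0 = y0 \<longrightarrow>
       (\<forall>t\<in>{t0..t0+\<delta>}.
          (y has_vector_derivative (\<Sum>\<sigma>\<in>P. f \<sigma> t (y t))) (at t within {t0..t0+\<delta>})) \<longrightarrow>
       (\<forall>\<^sub>F H in at_right 0. step f t0 y0 H (Y H) (y1 H)) \<longrightarrow>
       (\<forall>i\<in>S. ((\<lambda>H. Y H i) \<longlongrightarrow> y0) (at_right 0)) \<longrightarrow>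
       (\<lambda>H. norm (y1 H - y (t0 + H))) \<in> O[at_right 0](\<lambda>H. H ^ (p + 1)))"


definition rk_step ::
  "nat \<Rightarrow> (nat \<Rightarrow> nat \<Rightarrow> real) \<Rightarrow> (nat \<Rightarrow> real) \<Rightarrow> (nat \<Rightarrow> real) \<Rightarrow>
   (component \<Rightarrow> real \<Rightarrow> 'a \<Rightarrow> 'a) \<Rightarrow> real \<Rightarrow> 'a \<Rightarrow> real \<Rightarrow> (nat \<Rightarrow> 'a) \<Rightarrow> 'a::real_vector \<Rightarrow> bool" where
  "rk_step s A b c f t0 y0 H Y y1 \<longleftrightarrow>
     (\<forall>p\<in>{1..s}. Y p = y0 + H *\<^sub>R (\<Sum>l=1..s. A p l *\<^sub>R f Fast (t0 + c l * H) (Y l))) \<and>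
     y1 = y0 + H *\<^sub>R (\<Sum>l=1..s. b l *\<^sub>R f Fast (t0 + c l * H) (Y l))"

definition rk_order ::
  "nat \<Rightarrow> (nat \<Rightarrow> nat \<Rightarrow> real) \<Rightarrow> (nat \<Rightarrow> real) \<Rightarrow> (nat \<Rightarrow> real) \<Rightarrow>
   nat \<Rightarrow> ('a::euclidean_space) itself \<Rightarrow> bool" where
  "rk_order s A b c = has_order {Fast} {1..s}
     (rk_step s A b c :: (component \<Rightarrow> real \<Rightarrow> 'a \<Rightarrow> 'a) \<Rightarrow> _)"


definition E_mat :: "nat \<Rightarrow> nat \<Rightarrow> real" where
  "E_mat i j = (if i \<ge> j then 1 else 0)"

definition L_mat :: "nat \<Rightarrow> nat \<Rightarrow> real" where
  "L_mat i j = (if i = j + 1 then 1 else 0)"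

(* The superscript k of Gamma^{k} and Omega^{k} is the first argument of G. *)
definition bar_mat :: "nat \<Rightarrow> (nat \<Rightarrow> nat \<Rightarrow> nat \<Rightarrow> real) \<Rightarrow> nat \<Rightarrow> nat \<Rightarrow> real" where
  "bar_mat kmax G i j = (\<Sum>k=0..kmax. 1 / (real k + 1) * G k i j)"

definition base_mat :: "nat \<Rightarrow> nat \<Rightarrow> (nat \<Rightarrow> nat \<Rightarrow> nat \<Rightarrow> real) \<Rightarrow> nat \<Rightarrow> nat \<Rightarrow> real" where
  "base_mat s kmax G = mat_mult s E_mat (bar_mat kmax G)"

definition coeff_poly :: "nat \<Rightarrow> (nat \<Rightarrow> nat \<Rightarrow> nat \<Rightarrow> real) \<Rightarrow> nat \<Rightarrow> nat \<Rightarrow> real \<Rightarrow> real" where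
  "coeff_poly kmax G i j \<tau> = (\<Sum>k=0..kmax. G k i j * \<tau> ^ k)"

(* The weights are the last rows of AII and AEE, whence y1 = Y s. *)
definition imex_ark_step ::
  "nat \<Rightarrow> (nat \<Rightarrow> nat \<Rightarrow> real) \<Rightarrow> (nat \<Rightarrow> nat \<Rightarrow> real) \<Rightarrow> (nat \<Rightarrow> real) \<Rightarrow>
   (component \<Rightarrow> real \<Rightarrow> 'a \<Rightarrow> 'a) \<Rightarrow> real \<Rightarrow> 'a \<Rightarrow> real \<Rightarrow> (nat \<Rightarrow> 'a) \<Rightarrow> 'a::real_vector \<Rightarrow> bool" where
  "imex_ark_step s AII AEE c f t0 y0 H Y y1 \<longleftrightarrow>
     (\<forall>i\<in>{1..s}. Y i = y0
        + H *\<^sub>R (\<Sum>j=1..s. AII i j *\<^sub>R f Impl (t0 + c j * H) (Y j))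
        + H *\<^sub>R (\<Sum>j=1..s. AEE i j *\<^sub>R f Expl (t0 + c j * H) (Y j))) \<and>
     y1 = Y s"

definition imex_ark_order ::
  "nat \<Rightarrow> (nat \<Rightarrow> nat \<Rightarrow> real) \<Rightarrow> (nat \<Rightarrow> nat \<Rightarrow> real) \<Rightarrow> (nat \<Rightarrow> real) \<Rightarrow>
   nat \<Rightarrow> ('a::euclidean_space) itself \<Rightarrow> bool" where
  "imex_ark_order s AII AEE c = has_order {Impl, Expl} {1..s}
     (imex_ark_step s AII AEE c :: (component \<Rightarrow> real \<Rightarrow> 'a \<Rightarrow> 'a) \<Rightarrow> _)"


datatype mri_stage = Slow nat | FastStage nat nat

definition mri_stages :: "nat \<Rightarrow> nat \<Rightarrow> mri_stage set" where
  "mri_stages s sF = Slow ` {1..s} \<union> {FastStage i p | i p. i \<in> {2..s} \<and> p \<in> {1..sF}}"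

(* The right-hand side of the i-th fast initial value problem at the l-th node
   theta = cF l * H of the fast Runge-Kutta scheme. *)
definition mri_fast_rhs ::
  "(nat \<Rightarrow> real) \<Rightarrow> (nat \<Rightarrow> real) \<Rightarrow> nat \<Rightarrow>
   (nat \<Rightarrow> nat \<Rightarrow> nat \<Rightarrow> real) \<Rightarrow> (nat \<Rightarrow> nat \<Rightarrow> nat \<Rightarrow> real) \<Rightarrow> (nat \<Rightarrow> real) \<Rightarrow>
   (component \<Rightarrow> real \<Rightarrow> 'a \<Rightarrow> 'a) \<Rightarrow> real \<Rightarrow> real \<Rightarrow> (mri_stage \<Rightarrow> 'a) \<Rightarrow> nat \<Rightarrow> nat \<Rightarrow>
   'a::real_vector" where
  "mri_fast_rhs c \<Delta>c kmax \<Gamma> \<Omega> cF f t0 H Y i l =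
     \<Delta>c i *\<^sub>R f Fast (t0 + c (i - 1) * H + cF l * \<Delta>c i * H) (Y (FastStage i l))
     + (\<Sum>j=1..i. coeff_poly kmax \<Gamma> i j (cF l) *\<^sub>R f Impl (t0 + c j * H) (Y (Slow j)))
     + (\<Sum>j=1..<i. coeff_poly kmax \<Omega> i j (cF l) *\<^sub>R f Expl (t0 + c j * H) (Y (Slow j)))"

definition imex_mri_gark_step ::
  "nat \<Rightarrow> (nat \<Rightarrow> real) \<Rightarrow> (nat \<Rightarrow> real) \<Rightarrow> nat \<Rightarrow>
   (nat \<Rightarrow> nat \<Rightarrow> nat \<Rightarrow> real) \<Rightarrow> (nat \<Rightarrow> nat \<Rightarrow> nat \<Rightarrow> real) \<Rightarrow>
   nat \<Rightarrow> (nat \<Rightarrow> nat \<Rightarrow> real) \<Rightarrow> (nat \<Rightarrow> real) \<Rightarrow> (nat \<Rightarrow> real) \<Rightarrow>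
   (component \<Rightarrow> real \<Rightarrow> 'a \<Rightarrow> 'a) \<Rightarrow> real \<Rightarrow> 'a \<Rightarrow> real \<Rightarrow> (mri_stage \<Rightarrow> 'a) \<Rightarrow>
   'a::real_vector \<Rightarrow> bool" where
  "imex_mri_gark_step s c \<Delta>c kmax \<Gamma> \<Omega> sF AF bF cF f t0 y0 H Y y1 \<longleftrightarrow>
     Y (Slow 1) = y0 \<and>
     (\<forall>i\<in>{2..s}.
        (\<forall>p\<in>{1..sF}. Y (FastStage i p) = Y (Slow (i - 1))
           + H *\<^sub>R (\<Sum>l=1..sF. AF p l *\<^sub>R mri_fast_rhs c \<Delta>c kmax \<Gamma> \<Omega> cF f t0 H Y i l)) \<and>
        Y (Slow i) = Y (Slow (i - 1))
           + H *\<^sub>R (\<Sum>l=1..sF. bF l *\<^sub>R mri_fast_rhs c \<Delta>c kmax \<Gamma> \<Omega> cF f t0 H Y i l)) \<and>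
     y1 = Y (Slow s)"

definition imex_mri_gark_order ::
  "nat \<Rightarrow> (nat \<Rightarrow> real) \<Rightarrow> (nat \<Rightarrow> real) \<Rightarrow> nat \<Rightarrow>
   (nat \<Rightarrow> nat \<Rightarrow> nat \<Rightarrow> real) \<Rightarrow> (nat \<Rightarrow> nat \<Rightarrow> nat \<Rightarrow> real) \<Rightarrow>
   nat \<Rightarrow> (nat \<Rightarrow> nat \<Rightarrow> real) \<Rightarrow> (nat \<Rightarrow> real) \<Rightarrow> (nat \<Rightarrow> real) \<Rightarrow>
   nat \<Rightarrow> ('a::euclidean_space) itself \<Rightarrow> bool" where
  "imex_mri_gark_order s c \<Delta>c kmax \<Gamma> \<Omega> sF AF bF cF =
     has_order {Impl, Expl, Fast} (mri_stages s sF)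
       (imex_mri_gark_step s c \<Delta>c kmax \<Gamma> \<Omega> sF AF bF cF
          :: (component \<Rightarrow> real \<Rightarrow> 'a \<Rightarrow> 'a) \<Rightarrow> _)"


definition zeta :: "nat \<Rightarrow> (nat \<Rightarrow> nat \<Rightarrow> real) \<Rightarrow> (nat \<Rightarrow> real) \<Rightarrow> (nat \<Rightarrow> real) \<Rightarrow> nat \<Rightarrow> real" where
  "zeta sF AF bF cF k = dot sF bF (mat_vec sF AF (\<lambda>l. cF l ^ k))"

definition coupling_mat ::
  "nat \<Rightarrow> nat \<Rightarrow> (nat \<Rightarrow> nat \<Rightarrow> nat \<Rightarrow> real) \<Rightarrow>
   nat \<Rightarrow> (nat \<Rightarrow> nat \<Rightarrow> real) \<Rightarrow> (nat \<Rightarrow> real) \<Rightarrow> (nat \<Rightarrow> real) \<Rightarrow> nat \<Rightarrow> nat \<Rightarrow> real" where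
  "coupling_mat s kmax G sF AF bF cF i j =
     mat_mult s L_mat (base_mat s kmax G) i j + (\<Sum>k=0..kmax. zeta sF AF bF cF k * G k i j)"

end

theory Submission
  imports Defs
begin

text \<open>
  The fully discrete IMEX-MRI-GARK scheme, the base IMEX-ARK scheme and the fast Runge-Kutta scheme are
  all additive schemes over a finite stage set with a common node vector $d$, and internal consistency
  says that every coefficient matrix $A^\<sigma>$ has row sums $d$. For such a scheme, second-order Taylor
  expansion of the right-hand sides and explicit test problems show that order three is
  equivalent to $b^\<sigma> \cdot 1 = 1$, $b^\<sigma> \cdot d = 1/2$, $b^\<sigma> \cdot d^2 = 1/3$ and
  $b^\<sigma> A^\<tau> d = 1/6$ for all components $\<sigma>, \<tau>$. For the IMEX-MRI-GARK scheme the conditions with $\<sigma>, \<tau>$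
  slow are those of the base method. Since the fast method has order three, the fast part integrates
  quadratics exactly, so $A^F d$ equals $c^2/2$ at the slow stages and the conditions with $\<tau>$ or both
  components fast are automatic. Only the conditions with $\<sigma>$ fast and $\<tau>$ slow remain, and these
  are the coupling conditions.
\<close>

section \<open>Powers of the step size\<close>

text \<open>Internal consistency keeps the list of conditions short: since every
  \<open>A^\<sigma>\<close> has row sums \<open>d\<close>, stage \<open>i\<close> begins as
  \<open>y0 + H d_i F0\<close> with \<open>F0\<close> the sum of all components, so time and state
  move together along \<open>(1, F0)\<close>. Only the second-order stage terms, through
  \<open>A^\<tau> d\<close>, tell the components apart.

  Implicitness shapes the two directions differently. For sufficiency the stages are given and known
  merely to tend to \<open>y0\<close>; their expansions are bootstrapped from the stage equations,
  one power of \<open>H\<close> at a time. For necessity stage solutions must be exhibited, so the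
  test problems are polynomial in \<open>t\<close> or linear, and no implicit function theorem
  enters.

  The conditions called automatic are so only relative to the slow ones. A slow-fast condition is
  half of the condition \<open>b d^2 = 1/3\<close> of the base method, and the purely fast
  conditions evaluate to multiples of powers of the last node \<open>c_s\<close>, which equals 1
  because the slow weights sum both to 1 and to \<open>c_s\<close>.\<close>

definition O_pow :: "nat \<Rightarrow> (real \<Rightarrow> 'a::real_normed_vector) \<Rightarrow> bool" where
  "O_pow n u \<longleftrightarrow> (\<exists>K. \<forall>\<^sub>F h in at_right 0. norm (u h) \<le> K * h ^ n)"

lemma O_powI: "(\<forall>\<^sub>F h in at_right 0. norm (u h) \<le> K * h ^ n) \<Longrightarrow> O_pow n u"
  unfolding O_pow_def by blast

lemma O_powE:
  assumes "O_pow n u"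
  obtains K where "K \<ge> 0" "\<forall>\<^sub>F h in at_right 0. norm (u h) \<le> K * h ^ n"
proof -
  obtain K where K: "\<forall>\<^sub>F h in at_right 0. norm (u h) \<le> K * h ^ n"
    using assms unfolding O_pow_def by blast
  have "\<forall>\<^sub>F h in at_right 0. norm (u h) \<le> max K 0 * h ^ n"
    using K eventually_at_right_less[of "0::real"]
  proof eventually_elim
    case (elim h)
    then have "K * h ^ n \<le> max K 0 * h ^ n" by (intro mult_right_mono) auto
    with elim show ?case by linarith
  qed
  then show ?thesis using that[of "max K 0"] by auto
qed

lemma O_pow_cong_ev:
  assumes "O_pow n u" "\<forall>\<^sub>F h in at_right 0. v h = u h"
  shows "O_pow n v"
proof -
  obtain K where "\<forall>\<^sub>F h in at_right 0. norm (u h) \<le> K * h ^ n"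
    using assms(1) unfolding O_pow_def by blast
  then have "\<forall>\<^sub>F h in at_right 0. norm (v h) \<le> K * h ^ n"
    using assms(2) by eventually_elim simp
  then show ?thesis by (rule O_powI)
qed

lemma O_pow_cong: "O_pow n u \<Longrightarrow> (\<And>h. v h = u h) \<Longrightarrow> O_pow n v"
  by (rule O_pow_cong_ev) auto

lemma O_pow_zero [simp]: "O_pow n (\<lambda>h. 0)"
  by (rule O_powI[of _ 0]) auto

lemma O_pow_add: "O_pow n u \<Longrightarrow> O_pow n v \<Longrightarrow> O_pow n (\<lambda>h. u h + v h)"
proof -
  assume "O_pow n u" "O_pow n v"
  then obtain K L where "\<forall>\<^sub>F h in at_right 0. norm (u h) \<le> K * h ^ n"
    "\<forall>\<^sub>F h in at_right 0. norm (v h) \<le> L * h ^ n" unfolding O_pow_def by blast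
  then have "\<forall>\<^sub>F h in at_right 0. norm (u h + v h) \<le> (K + L) * h ^ n"
  proof eventually_elim
    case (elim h)
    then show ?case using norm_triangle_ineq[of "u h" "v h"] by (simp add: algebra_simps)
  qed
  then show ?thesis by (rule O_powI)
qed

lemma O_pow_bounded_linear:
  assumes "bounded_linear T" "O_pow n u"
  shows "O_pow n (\<lambda>h. T (u h))"
proof -
  obtain M where M: "\<And>x. norm (T x) \<le> norm x * M" and M0: "M > 0"
    using bounded_linear.pos_bounded[OF assms(1)] by blast
  obtain K where "\<forall>\<^sub>F h in at_right 0. norm (u h) \<le> K * h ^ n"
    using assms(2) unfolding O_pow_def by blast
  then have "\<forall>\<^sub>F h in at_right 0. norm (T (u h)) \<le> (M * K) * h ^ n"
  proof eventually_elim
    case (elim h)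
    have "norm (T (u h)) \<le> norm (u h) * M" by (rule M)
    also have "\<dots> \<le> (K * h ^ n) * M" using elim M0 by (intro mult_right_mono) auto
    finally show ?case by (simp add: algebra_simps)
  qed
  then show ?thesis by (rule O_powI)
qed

lemma O_pow_minus: "O_pow n u \<Longrightarrow> O_pow n (\<lambda>h. - u h)"
  by (simp add: O_pow_def)

lemma O_pow_diff: "O_pow n u \<Longrightarrow> O_pow n v \<Longrightarrow> O_pow n (\<lambda>h. u h - v h)"
  using O_pow_add[OF _ O_pow_minus, of n u v] by simp

lemma O_pow_scaleR: "O_pow n u \<Longrightarrow> O_pow n (\<lambda>h. r *\<^sub>R u h)"
  by (rule O_pow_bounded_linear[OF bounded_linear_scaleR_right])

lemma O_pow_sum: "(\<And>i. i \<in> I \<Longrightarrow> O_pow n (u i)) \<Longrightarrow> O_pow n (\<lambda>h. \<Sum>i\<in>I. u i h)"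
proof (induction I rule: infinite_finite_induct)
  case (insert x F)
  then show ?case by (simp add: O_pow_add)
qed auto

lemma O_pow_Suc_scaleR: "O_pow n u \<Longrightarrow> O_pow (Suc n) (\<lambda>h. h *\<^sub>R u h)"
proof -
  assume "O_pow n u"
  then obtain K where "\<forall>\<^sub>F h in at_right 0. norm (u h) \<le> K * h ^ n" unfolding O_pow_def by blast
  then have "\<forall>\<^sub>F h in at_right 0. norm (h *\<^sub>R u h) \<le> K * h ^ Suc n"
    using eventually_at_right_less[of "0::real"]
  proof eventually_elim
    case (elim h)
    then have "h * norm (u h) \<le> h * (K * h ^ n)" by (intro mult_left_mono) auto
    with elim show ?case by (simp add: algebra_simps)
  qed
  then show ?thesis by (rule O_powI)
qed

lemma O_pow_power: "O_pow n (\<lambda>h. h ^ n *\<^sub>R a)"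
proof (rule O_powI[of _ "norm a"])
  show "\<forall>\<^sub>F h in at_right 0. norm (h ^ n *\<^sub>R a) \<le> norm a * h ^ n"
    using eventually_at_right_less[of "0::real"] by eventually_elim simp
qed

lemma O_pow_mono:
  assumes "O_pow n u" "m \<le> n"
  shows "O_pow m u"
proof -
  obtain K where K0: "K \<ge> 0" and K: "\<forall>\<^sub>F h in at_right 0. norm (u h) \<le> K * h ^ n"
    using assms(1) by (rule O_powE)
  have "\<forall>\<^sub>F h in at_right 0. h \<in> {0<..<1::real}"
    by (rule eventually_at_right_real) simp
  then have "\<forall>\<^sub>F h in at_right 0. norm (u h) \<le> K * h ^ m" using K
  proof eventually_elim
    case (elim h)
    then have "K * h ^ n \<le> K * h ^ m" using K0 assms(2)
      by (intro mult_left_mono power_decreasing) auto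
    with elim show ?case by linarith
  qed
  then show ?thesis by (rule O_powI)
qed

lemma O_pow_Pair: "O_pow n u \<Longrightarrow> O_pow n v \<Longrightarrow> O_pow n (\<lambda>h. (u h, v h))"
proof -
  assume "O_pow n u" "O_pow n v"
  then have "O_pow n (\<lambda>h. (u h, 0) + (0, v h))"
    by (intro O_pow_add O_pow_bounded_linear[where T = "\<lambda>x. (x, 0)"] O_pow_bounded_linear[where T = "\<lambda>x. (0, x)"]
        bounded_linear_Pair bounded_linear_ident bounded_linear_zero)
  then show ?thesis by (rule O_pow_cong) simp
qed

lemma O_pow_tendsto:
  assumes "(u \<longlongrightarrow> l) (at_right (0::real))"
  shows "O_pow 0 u"
proof (rule O_powI[of _ "norm l + 1"])
  have "((\<lambda>h. norm (u h)) \<longlongrightarrow> norm l) (at_right 0)" using assms by (rule tendsto_norm)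
  then have "\<forall>\<^sub>F h in at_right 0. norm (u h) < norm l + 1" by (rule order_tendstoD) simp
  then show "\<forall>\<^sub>F h in at_right 0. norm (u h) \<le> (norm l + 1) * h ^ 0"
    by eventually_elim simp
qed

lemma O_pow_imp_tendsto:
  assumes "O_pow (Suc n) u"
  shows "(u \<longlongrightarrow> 0) (at_right 0)"
proof -
  obtain K where K0: "K \<ge> 0" and K: "\<forall>\<^sub>F h in at_right 0. norm (u h) \<le> K * h ^ Suc n"
    using assms(1) by (rule O_powE)
  have "((\<lambda>h. K * h ^ Suc n) \<longlongrightarrow> K * 0 ^ Suc n) (at_right (0::real))"
    by (intro tendsto_intros)
  then have "((\<lambda>h. K * h ^ Suc n) \<longlongrightarrow> 0) (at_right (0::real))" by simp
  then show ?thesis by (rule Lim_null_comparison[OF K])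
qed

text \<open>Order conditions are read off here: once every other term of the error has higher order,
  a remaining pure power \<open>h^n a\<close> must vanish.\<close>

lemma O_pow_power_imp_zero:
  assumes "O_pow (Suc n) (\<lambda>h. h ^ n *\<^sub>R a)"
  shows "a = 0"
proof -
  obtain K where K0: "K \<ge> 0" and K: "\<forall>\<^sub>F h in at_right 0. norm (h ^ n *\<^sub>R a) \<le> K * h ^ Suc n"
    using assms(1) by (rule O_powE)
  from K have "\<forall>\<^sub>F h in at_right 0. norm a \<le> K * h ^ Suc 0" 
    using eventually_at_right_less[of "0::real"]
  proof eventually_elim
    case (elim h)
    then have "h ^ n * norm a \<le> h ^ n * (K * h)" by (simp add: algebra_simps)
    then show ?case using elim by simp
  qed
  then have "O_pow (Suc 0) (\<lambda>h. a)" by (rule O_powI)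
  then have "((\<lambda>h. a) \<longlongrightarrow> 0) (at_right (0::real))" by (rule O_pow_imp_tendsto)
  then show ?thesis
    using tendsto_unique[OF trivial_limit_at_right_real tendsto_const] by metis
qed

lemma O_pow_iff_bigo:
  "(\<lambda>h. norm (u h)) \<in> O[at_right 0](\<lambda>h. h ^ n) \<longleftrightarrow> O_pow n u"
proof
  assume "(\<lambda>h. norm (u h)) \<in> O[at_right 0](\<lambda>h. h ^ n)"
  then obtain K where "\<forall>\<^sub>F h in at_right 0. norm (norm (u h)) \<le> K * norm (h ^ n)"
    by (rule landau_o.bigE)
  then have "\<forall>\<^sub>F h in at_right 0. norm (u h) \<le> K * h ^ n"
    using eventually_at_right_less[of "0::real"] by eventually_elim simp
  then show "O_pow n u" by (rule O_powI)
next
  assume "O_pow n u"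
  then obtain K where "\<forall>\<^sub>F h in at_right 0. norm (u h) \<le> K * h ^ n" unfolding O_pow_def by blast
  then have "\<forall>\<^sub>F h in at_right 0. norm (norm (u h)) \<le> K * norm (h ^ n)"
    using eventually_at_right_less[of "0::real"] by eventually_elim simp
  then show "(\<lambda>h. norm (u h)) \<in> O[at_right 0](\<lambda>h. h ^ n)" by (rule bigoI)
qed

text \<open>Integration gains one power of \<open>h\<close>. The mean value inequality against
  \<open>K h^(n+1) / (n+1)\<close> replaces an integral, so \<open>u'\<close> may be any derivative,
  continuous or not.\<close>

lemma O_pow_integrate:
  assumes "\<delta> > 0" "u 0 = 0"
    and der: "\<And>h. h \<in> {0..\<delta>} \<Longrightarrow> (u has_vector_derivative u' h) (at h within {0..\<delta>})"
    and "O_pow n u'"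
  shows "O_pow (Suc n) u"
proof -
  obtain K where K: "\<forall>\<^sub>F h in at_right 0. norm (u' h) \<le> K * h ^ n"
    using assms(4) unfolding O_pow_def by blast
  then obtain e where e: "e > 0" "\<And>h. 0 < h \<Longrightarrow> h < e \<Longrightarrow> norm (u' h) \<le> K * h ^ n"
    unfolding eventually_at_right_field by auto
  have "\<forall>\<^sub>F h in at_right 0. h \<in> {0<..<min e \<delta>}"
    by (rule eventually_at_right_real) (use e assms in auto)
  then have "\<forall>\<^sub>F h in at_right 0. norm (u h) \<le> K / real (Suc n) * h ^ Suc n"
  proof eventually_elim
    case (elim h)
    define \<phi> where "\<phi> x = K / real (Suc n) * x ^ Suc n" for x :: real
    have "norm (u h - u 0) \<le> \<phi> h - \<phi> 0"
    proof (rule differentiable_bound_general[where f' = u' and \<phi>' = "\<lambda>x. K * x ^ n"])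
      show "0 < h" using elim by simp
      have "continuous_on {0..\<delta>} u"
        using der has_vector_derivative_continuous continuous_on_eq_continuous_within by blast
      then show "continuous_on {0..h} u" by (rule continuous_on_subset) (use elim in auto)
      show "continuous_on {0..h} \<phi>" unfolding \<phi>_def by (intro continuous_intros)
      fix x :: real assume x: "0 < x" "x < h"
      have "(u has_vector_derivative u' x) (at x within {0<..<\<delta>})"
        by (rule has_vector_derivative_within_subset[OF der]) (use x elim in auto)
      then show "(u has_vector_derivative u' x) (at x)"
        using x elim by (subst (asm) at_within_open) auto
      show "(\<phi> has_vector_derivative K * x ^ n) (at x)"
        unfolding \<phi>_def has_real_derivative_iff_has_vector_derivative[symmetric]
        by (auto intro!: derivative_eq_intros simp del: power_Suc)
      show "norm (u' x) \<le> K * x ^ n" using e x elim by auto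
    qed
    then show ?case using assms(2) by (simp add: \<phi>_def)
  qed
  then show ?thesis by (rule O_powI)
qed

section \<open>Taylor expansion\<close>

text \<open>\<open>C_k\<close> speaks of one fixed direction at a time. Resolving a direction into
  the finitely many basis vectors makes the Taylor bounds uniform over all directions.\<close>

lemma frechet_derivative_Basis:
  fixes g :: "'p::euclidean_space \<Rightarrow> 'c::real_normed_vector"
  assumes "g differentiable (at x)"
  shows "frechet_derivative g (at x) v = (\<Sum>b\<in>Basis. (v \<bullet> b) *\<^sub>R frechet_derivative g (at x) b)"
proof -
  have l: "linear (frechet_derivative g (at x))" by (rule linear_frechet_derivative[OF assms])
  have "frechet_derivative g (at x) v = frechet_derivative g (at x) (\<Sum>b\<in>Basis. (v \<bullet> b) *\<^sub>R b)"
    by (simp add: euclidean_representation)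
  then show ?thesis by (simp add: linear_sum[OF l] linear_scale[OF l])
qed

text \<open>
  Expanding along the segment from \<open>x0\<close> to \<open>x0 + v\<close> only needs expansions of the partial derivatives;
  in particular no symmetry of the second derivative is used.
\<close>

lemma line_Taylor_step:
  fixes g :: "'p::euclidean_space \<Rightarrow> 'c::real_normed_vector"
  assumes g: "\<And>x. g differentiable (at x)"
    and q: "\<And>b. b \<in> Basis \<Longrightarrow> \<exists>K. \<forall>v. norm v \<le> 1 \<longrightarrow>
        norm (frechet_derivative g (at (x0 + v)) b - q b v) \<le> K * norm v ^ n"
    and p: "\<And>v s. ((\<lambda>s. p s v) has_vector_derivative (\<Sum>b\<in>Basis. (v \<bullet> b) *\<^sub>R q b (s *\<^sub>R v))) (at s)"
  shows "\<exists>K. \<forall>v. norm v \<le> 1 \<longrightarrow> norm (g (x0 + v) - g x0 - (p 1 v - p 0 v)) \<le> K * norm v ^ Suc n"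
proof -
  obtain K where K: "\<And>b v. b \<in> Basis \<Longrightarrow> norm v \<le> 1 \<Longrightarrow>
      norm (frechet_derivative g (at (x0 + v)) b - q b v) \<le> K b * norm v ^ n"
    using q by metis
  define M where "M = (\<Sum>b\<in>(Basis :: 'p set). \<bar>K b\<bar>)"
  have "norm (g (x0 + v) - g x0 - (p 1 v - p 0 v)) \<le> M * norm v ^ Suc n" if v: "norm v \<le> 1" for v
  proof -
    \<comment> \<open>The mean value inequality is applied to this remainder along the segment; its
      derivative gains one factor \<open>norm v\<close> from the coordinates
      \<open>v \<bullet> b\<close>.\<close>
    define r where "r s = g (x0 + s *\<^sub>R v) - p s v" for s
    define r' where "r' s = (\<Sum>b\<in>Basis. (v \<bullet> b) *\<^sub>R
        (frechet_derivative g (at (x0 + s *\<^sub>R v)) b - q b (s *\<^sub>R v)))" for s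
    have der: "(r has_vector_derivative r' s) (at s)" for s
    proof -
      have "((\<lambda>s. x0 + s *\<^sub>R v) has_vector_derivative v) (at s)"
        by (auto intro!: derivative_eq_intros)
      moreover have "(g has_derivative frechet_derivative g (at (x0 + s *\<^sub>R v))) (at (x0 + s *\<^sub>R v))"
        using g frechet_derivative_works by blast
      ultimately have "((g \<circ> (\<lambda>s. x0 + s *\<^sub>R v)) has_vector_derivative
          frechet_derivative g (at (x0 + s *\<^sub>R v)) v) (at s)"
        by (intro vector_derivative_diff_chain_within)
          (auto intro: has_derivative_at_withinI)
      then have "(r has_vector_derivative
          frechet_derivative g (at (x0 + s *\<^sub>R v)) v - (\<Sum>b\<in>Basis. (v \<bullet> b) *\<^sub>R q b (s *\<^sub>R v))) (at s)"
        unfolding r_def o_def by (intro has_vector_derivative_diff p)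
      moreover have "frechet_derivative g (at (x0 + s *\<^sub>R v)) v - (\<Sum>b\<in>Basis. (v \<bullet> b) *\<^sub>R q b (s *\<^sub>R v)) = r' s"
        unfolding r'_def by (subst frechet_derivative_Basis[OF g])
          (simp add: sum_subtractf scaleR_diff_right)
      ultimately show ?thesis by simp
    qed
    have bound: "norm (r' s) \<le> M * norm v ^ Suc n" if s: "0 < s" "s < 1" for s
    proof -
      have sv: "norm (s *\<^sub>R v) \<le> norm v" using s by (simp add: mult_left_le_one_le)
      have "norm (r' s) \<le> (\<Sum>b\<in>Basis. \<bar>v \<bullet> b\<bar> *
        norm (frechet_derivative g (at (x0 + s *\<^sub>R v)) b - q b (s *\<^sub>R v)))"
        unfolding r'_def by (rule norm_sum[THEN order_trans]) simp
      also have "\<dots> \<le> (\<Sum>b\<in>Basis. norm v * (\<bar>K b\<bar> * norm v ^ n))"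
      proof (rule sum_mono, rule mult_mono)
        fix b :: 'p assume b: "b \<in> Basis"
        show "\<bar>v \<bullet> b\<bar> \<le> norm v" using b by (rule Basis_le_norm)
        have "norm (frechet_derivative g (at (x0 + s *\<^sub>R v)) b - q b (s *\<^sub>R v)) \<le> K b * norm (s *\<^sub>R v) ^ n"
          by (rule K[OF b order_trans[OF sv v]])
        also have "\<dots> \<le> \<bar>K b\<bar> * norm v ^ n"
          by (intro mult_mono power_mono sv) auto
        finally show "norm (frechet_derivative g (at (x0 + s *\<^sub>R v)) b - q b (s *\<^sub>R v)) \<le> \<bar>K b\<bar> * norm v ^ n" .
      qed auto
      also have "\<dots> = M * norm v ^ Suc n"
        by (simp add: M_def sum_distrib_right sum_distrib_left algebra_simps)
      finally show ?thesis .
    qed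
    have "norm (r 1 - r 0) \<le> M * norm v ^ Suc n * 1 - M * norm v ^ Suc n * 0"
    proof (rule differentiable_bound_general[where f' = r' and \<phi>' = "\<lambda>_. M * norm v ^ Suc n"])
      show "continuous_on {0..1} r"
        using der by (meson continuous_at_imp_continuous_on has_vector_derivative_continuous)
      show "((\<lambda>x. M * norm v ^ Suc n * x) has_vector_derivative M * norm v ^ Suc n) (at x)" for x
        unfolding has_real_derivative_iff_has_vector_derivative[symmetric]
        by (auto intro!: derivative_eq_intros)
    qed (use der bound in \<open>auto intro!: continuous_intros\<close>)
    then show ?thesis by (simp add: r_def algebra_simps)
  qed
  then show ?thesis by blast
qed

text \<open>Start of a ladder: compactness of the closed unit ball gives a bound of order 0, and
  each use of \<open>line_Taylor_step\<close> on the partial derivatives raises the order by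
  one.\<close>

lemma continuous_bounded_near:
  fixes g :: "'p::euclidean_space \<Rightarrow> 'c::real_normed_vector"
  assumes "continuous_on UNIV g"
  shows "\<exists>K. \<forall>v. norm v \<le> 1 \<longrightarrow> norm (g (x0 + v)) \<le> K"
proof -
  have "compact (g ` cball x0 1)"
    by (intro compact_continuous_image continuous_on_subset[OF assms]) auto
  then obtain K where K: "\<And>x. x \<in> g ` cball x0 1 \<Longrightarrow> norm x \<le> K"
    using compact_imp_bounded bounded_iff by metis
  have "norm (g (x0 + v)) \<le> K" if "norm v \<le> 1" for v
    by (rule K) (use that in \<open>auto simp: dist_norm\<close>)
  then show ?thesis by blast
qed

lemma C_1_Taylor:
  fixes g :: "'p::euclidean_space \<Rightarrow> 'c::real_normed_vector"
  assumes "C_k (Suc 0) g"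
  shows "\<exists>K. \<forall>v. norm v \<le> 1 \<longrightarrow> norm (g (x0 + v) - g x0) \<le> K * norm v"
proof -
  have "\<exists>K. \<forall>v. norm v \<le> 1 \<longrightarrow> norm (g (x0 + v) - g x0 - (0 - 0)) \<le> K * norm v ^ Suc 0"
    by (rule line_Taylor_step[where q = "\<lambda>_ _. 0" and p = "\<lambda>_ _. 0"])
      (use assms in \<open>auto intro!: continuous_bounded_near\<close>)
  then show ?thesis by simp
qed

lemma C_2_Taylor:
  fixes g :: "'p::euclidean_space \<Rightarrow> 'c::real_normed_vector"
  assumes "C_k 2 g"
  shows "\<exists>K. \<forall>v. norm v \<le> 1 \<longrightarrow>
    norm (g (x0 + v) - g x0 - frechet_derivative g (at x0) v) \<le> K * norm v ^ 2"
proof -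
  have g: "\<And>x. g differentiable (at x)"
    and g1: "\<And>b. C_k (Suc 0) (\<lambda>x. frechet_derivative g (at x) b)"
    using assms by (auto simp: numeral_2_eq_2)
  let ?p = "\<lambda>s v. s *\<^sub>R frechet_derivative g (at x0) v"
  have "\<exists>K. \<forall>v. norm v \<le> 1 \<longrightarrow> norm (g (x0 + v) - g x0 - (?p 1 v - ?p 0 v)) \<le> K * norm v ^ Suc 1"
  proof (rule line_Taylor_step[where q = "\<lambda>b _. frechet_derivative g (at x0) b"])
    show "((\<lambda>s. s *\<^sub>R frechet_derivative g (at x0) v) has_vector_derivative
        (\<Sum>b\<in>Basis. (v \<bullet> b) *\<^sub>R frechet_derivative g (at x0) b)) (at s)" for s v
      unfolding frechet_derivative_Basis[OF g, symmetric] by (auto intro!: derivative_eq_intros)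
  qed (use g C_1_Taylor[OF g1] in auto)
  then show ?thesis by (simp add: numeral_2_eq_2)
qed

lemma C_3_Taylor:
  fixes g :: "'p::euclidean_space \<Rightarrow> 'c::real_normed_vector"
  assumes "C_k 3 g"
  obtains D B K where "bounded_linear D" "bounded_bilinear B"
    "\<And>v. norm v \<le> 1 \<Longrightarrow> norm (g (x0 + v) - g x0 - D v - B v v) \<le> K * norm v ^ 3"
proof -
  have g: "\<And>x. g differentiable (at x)"
    and g2: "\<And>b. C_k 2 (\<lambda>x. frechet_derivative g (at x) b)"
    using assms by (auto simp: numeral_3_eq_3 numeral_2_eq_2)
  define D where "D = frechet_derivative g (at x0)"
  define D2 where "D2 b = frechet_derivative (\<lambda>x. frechet_derivative g (at x) b) (at x0)" for b
  \<comment> \<open>The factor 1/2 cancels the 2 from differentiating \<open>s\<^sup>2\<close> in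
    \<open>?p\<close>, so that the derivative of \<open>?p\<close> is the expansion of the
    directional derivative.\<close>
  define B where "B v w = (1/2) *\<^sub>R (\<Sum>b\<in>Basis. (v \<bullet> b) *\<^sub>R D2 b w)" for v w
  have D: "bounded_linear D"
    unfolding D_def using g frechet_derivative_works has_derivative_bounded_linear by blast
  have D2: "bounded_linear (D2 b)" for b
    using g2[of b] frechet_derivative_works has_derivative_bounded_linear
    unfolding D2_def by (metis C_k.simps(2) Suc_1)
  interpret D2: bounded_linear "D2 b" for b by (rule D2)
  have B: "bounded_bilinear B"
    unfolding bilinear_conv_bounded_bilinear[symmetric] bilinear_def B_def
    by (auto intro!: linearI simp: sum.distrib[symmetric] D2.add D2.scaleR inner_add_left
        scaleR_add_left add_divide_distrib scaleR_add_right scaleR_sum_right mult_ac)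
  let ?p = "\<lambda>s v. s *\<^sub>R D v + s\<^sup>2 *\<^sub>R B v v"
  have "\<exists>K. \<forall>v. norm v \<le> 1 \<longrightarrow> norm (g (x0 + v) - g x0 - (?p 1 v - ?p 0 v)) \<le> K * norm v ^ Suc 2"
  proof (rule line_Taylor_step[where q = "\<lambda>b v. frechet_derivative g (at x0) b + D2 b v"])
    show "((\<lambda>s. s *\<^sub>R D v + s\<^sup>2 *\<^sub>R B v v) has_vector_derivative
        (\<Sum>b\<in>Basis. (v \<bullet> b) *\<^sub>R (frechet_derivative g (at x0) b + D2 b (s *\<^sub>R v)))) (at s)" for s v
    proof -
      have "(\<Sum>b\<in>Basis. (v \<bullet> b) *\<^sub>R (frechet_derivative g (at x0) b + D2 b (s *\<^sub>R v))) =
         D v + (2 * s) *\<^sub>R B v v"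
        unfolding D_def frechet_derivative_Basis[OF g, of _ v]
        by (simp add: B_def sum.distrib scaleR_add_right D2.scaleR scaleR_sum_right algebra_simps)
      then show ?thesis by (auto intro!: derivative_eq_intros)
    qed
    show "\<exists>K. \<forall>v. norm v \<le> 1 \<longrightarrow> norm (frechet_derivative g (at (x0 + v)) b - 
      (frechet_derivative g (at x0) b + D2 b v)) \<le> K * norm v ^ 2" for b
      using C_2_Taylor[OF g2[of b]] by (simp add: D2_def diff_diff_eq)
  qed (use g in auto)
  then show ?thesis using that[OF D B] by (fastforce simp: diff_diff_eq add.assoc numeral_3_eq_3 numeral_2_eq_2)
qed

lemma O_pow_bilinear:
  assumes "bounded_bilinear B" "O_pow m u" "O_pow n v"
  shows "O_pow (m + n) (\<lambda>h. B (u h) (v h))"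
proof -
  obtain M where M: "\<And>x y. norm (B x y) \<le> norm x * norm y * M" and M0: "M > 0"
    using bounded_bilinear.pos_bounded[OF assms(1)] by blast
  obtain K where K0: "K \<ge> 0" and K: "\<forall>\<^sub>F h in at_right 0. norm (u h) \<le> K * h ^ m"
    using assms(2) by (rule O_powE)
  obtain L where L0: "L \<ge> 0" and L: "\<forall>\<^sub>F h in at_right 0. norm (v h) \<le> L * h ^ n"
    using assms(3) by (rule O_powE)
  have "\<forall>\<^sub>F h in at_right 0. norm (B (u h) (v h)) \<le> (K * L * M) * h ^ (m + n)"
    using K L eventually_at_right_less[of "0::real"]
  proof eventually_elim
    case (elim h)
    have "norm (B (u h) (v h)) \<le> norm (u h) * norm (v h) * M" by (rule M)
    also have "\<dots> \<le> (K * h ^ m) * (L * h ^ n) * M"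
      using elim M0 K0 L0 by (intro mult_right_mono mult_mono) auto
    finally show ?case by (simp add: power_add algebra_simps)
  qed
  then show ?thesis by (rule O_powI)
qed

text \<open>
  \<open>D\<close> and \<open>Q\<close> play the roles of the first and of half the second derivative of \<open>g\<close> at \<open>x0\<close>.
\<close>

definition second_order_expansion ::
  "('p::real_normed_vector \<Rightarrow> 'c::real_normed_vector) \<Rightarrow> 'p \<Rightarrow> ('p \<Rightarrow> 'c) \<Rightarrow> ('p \<Rightarrow> 'c) \<Rightarrow> bool" where
  "second_order_expansion g x0 D Q \<longleftrightarrow>
     bounded_linear D \<and> (\<forall>r a. Q (r *\<^sub>R a) = r\<^sup>2 *\<^sub>R Q a) \<and>
     (\<forall>v. (v \<longlongrightarrow> 0) (at_right 0) \<longrightarrow> O_pow 0 (\<lambda>h. g (x0 + v h))) \<and>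
     (\<forall>v. O_pow 1 v \<longrightarrow> O_pow 1 (\<lambda>h. g (x0 + v h) - g x0)) \<and>
     (\<forall>v a. O_pow 2 (\<lambda>h. v h - h *\<^sub>R a) \<longrightarrow>
        O_pow 2 (\<lambda>h. g (x0 + v h) - g x0 - h *\<^sub>R D a)) \<and>
     (\<forall>v a w. O_pow 3 (\<lambda>h. v h - h *\<^sub>R a - h\<^sup>2 *\<^sub>R w) \<longrightarrow>
        O_pow 3 (\<lambda>h. g (x0 + v h) - g x0 - h *\<^sub>R D a - h\<^sup>2 *\<^sub>R (D w + Q a)))"

text \<open>The clauses form a ladder: an expansion of the argument \<open>v\<close> to some order
  yields one of \<open>g (x0 + v)\<close> to the same order. \<open>Q\<close> is later evaluated
  only on multiples of \<open>(1, F0)\<close>, so quadratic homogeneity is all that is recorded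
  about it.\<close>

lemma C_3_second_order_expansion:
  fixes g :: "'p::euclidean_space \<Rightarrow> 'c::real_normed_vector"
  assumes "C_k 3 g"
  shows "\<exists>D Q. second_order_expansion g x0 D Q"
proof -
  obtain D B K where D: "bounded_linear D" and B: "bounded_bilinear B"
    and K: "\<And>v. norm v \<le> 1 \<Longrightarrow> norm (g (x0 + v) - g x0 - D v - B v v) \<le> K * norm v ^ 3"
    using C_3_Taylor[OF assms] by blast
  interpret D: bounded_linear D by (rule D)
  interpret B: bounded_bilinear B by (rule B)
  define R where "R v = g (x0 + v) - g x0 - D v - B v v" for v
  have R: "O_pow 3 (\<lambda>h. R (v h))" if v: "O_pow 1 v" for v
  proof -
    obtain L where L0: "L \<ge> 0" and L: "\<forall>\<^sub>F h in at_right 0. norm (v h) \<le> L * h ^ 1"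
      using v by (rule O_powE)
    have "((\<lambda>h. norm (v h)) \<longlongrightarrow> 0) (at_right 0)"
      using O_pow_imp_tendsto[of 0 v] v by (simp add: tendsto_norm_zero)
    then have "\<forall>\<^sub>F h in at_right 0. norm (v h) < 1" by (rule order_tendstoD) simp
    then have "\<forall>\<^sub>F h in at_right 0. norm (R (v h)) \<le> (\<bar>K\<bar> * L ^ 3) * h ^ 3" using L
    proof eventually_elim
      case (elim h)
      have "norm (R (v h)) \<le> K * norm (v h) ^ 3" unfolding R_def using elim by (intro K) auto
      also have "\<dots> \<le> \<bar>K\<bar> * (L * h) ^ 3" using elim by (intro mult_mono power_mono) auto
      finally show ?case by (simp add: power_mult_distrib)
    qed
    then show ?thesis by (rule O_powI)
  qed
  have "second_order_expansion g x0 D (\<lambda>a. B a a)"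
    unfolding second_order_expansion_def
  proof (intro conjI allI impI)
    show "bounded_linear D" by (rule D)
    show "B (r *\<^sub>R a) (r *\<^sub>R a) = r\<^sup>2 *\<^sub>R B a a" for r a
      by (simp add: B.scaleR_left B.scaleR_right power2_eq_square)
  next
    fix v :: "real \<Rightarrow> 'p" assume v: "(v \<longlongrightarrow> 0) (at_right 0)"
    have "isCont g x0"
      using assms by (auto simp: numeral_3_eq_3 intro: differentiable_imp_continuous_within)
    moreover have "((\<lambda>h. x0 + v h) \<longlongrightarrow> x0) (at_right 0)"
      using tendsto_add[OF tendsto_const v] by simp
    ultimately show "O_pow 0 (\<lambda>h. g (x0 + v h))"
      by (intro O_pow_tendsto) (rule isCont_tendsto_compose)
  next
    fix v :: "real \<Rightarrow> 'p" assume v: "O_pow 1 v"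
    have "O_pow (1 + 1) (\<lambda>h. B (v h) (v h))" by (rule O_pow_bilinear[OF B v v])
    then have "O_pow 1 (\<lambda>h. R (v h) + D (v h) + B (v h) (v h))"
      by (intro O_pow_add O_pow_bounded_linear[OF D v] O_pow_mono[OF R[OF v]]) (auto intro: O_pow_mono)
    then show "O_pow 1 (\<lambda>h. g (x0 + v h) - g x0)"
      by (rule O_pow_cong) (simp add: R_def)
  next
    fix v :: "real \<Rightarrow> 'p" and a assume v: "O_pow 2 (\<lambda>h. v h - h *\<^sub>R a)"
    have "O_pow 1 (\<lambda>h. (v h - h *\<^sub>R a) + h ^ 1 *\<^sub>R a)"
      by (intro O_pow_add O_pow_power O_pow_mono[OF v]) simp
    then have v1: "O_pow 1 v" by simp
    have "O_pow (1 + 1) (\<lambda>h. B (v h) (v h))" by (rule O_pow_bilinear[OF B v1 v1])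
    then have "O_pow 2 (\<lambda>h. B (v h) (v h))" by (simp add: numeral_2_eq_2)
    then have "O_pow 2 (\<lambda>h. R (v h) + D (v h - h *\<^sub>R a) + B (v h) (v h))"
      by (intro O_pow_add O_pow_bounded_linear[OF D v] O_pow_mono[OF R[OF v1]]) auto
    then show "O_pow 2 (\<lambda>h. g (x0 + v h) - g x0 - h *\<^sub>R D a)"
      by (rule O_pow_cong) (simp add: R_def D.diff D.scaleR)
  next
    fix v :: "real \<Rightarrow> 'p" and a w assume v: "O_pow 3 (\<lambda>h. v h - h *\<^sub>R a - h\<^sup>2 *\<^sub>R w)"
    have "O_pow 2 (\<lambda>h. (v h - h *\<^sub>R a - h\<^sup>2 *\<^sub>R w) + h ^ 2 *\<^sub>R w)"
      by (intro O_pow_add O_pow_power O_pow_mono[OF v]) simp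
    then have v2: "O_pow 2 (\<lambda>h. v h - h *\<^sub>R a)" by simp
    have "O_pow 1 (\<lambda>h. (v h - h *\<^sub>R a) + h ^ 1 *\<^sub>R a)"
      by (intro O_pow_add O_pow_power O_pow_mono[OF v2]) simp
    then have v1: "O_pow 1 v" by simp
    \<comment> \<open>\<open>B v v - h^2 B a a\<close> splits into \<open>B v (v - h a)\<close> and
      \<open>B (v - h a) (h a)\<close>. In each term the factors have orders 1 and 2, hence 3
      together.\<close>
    have "O_pow 3 (\<lambda>h. B (v h) (v h - h *\<^sub>R a))" using O_pow_bilinear[OF B v1 v2] by (simp add: numeral_3_eq_3)
    moreover have "O_pow (2 + 1) (\<lambda>h. B (v h - h *\<^sub>R a) (h ^ 1 *\<^sub>R a))"
      by (rule O_pow_bilinear[OF B v2 O_pow_power])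
    ultimately have "O_pow 3 (\<lambda>h. R (v h) + D (v h - h *\<^sub>R a - h\<^sup>2 *\<^sub>R w)
        + B (v h) (v h - h *\<^sub>R a) + B (v h - h *\<^sub>R a) (h ^ 1 *\<^sub>R a))"
      by (intro O_pow_add O_pow_bounded_linear[OF D v] R[OF v1]) auto
    then show "O_pow 3 (\<lambda>h. g (x0 + v h) - g x0 - h *\<^sub>R D a - h\<^sup>2 *\<^sub>R (D w + B a a))"
      by (rule O_pow_cong)
        (simp add: R_def D.add D.diff D.scaleR B.diff_left B.diff_right B.scaleR_left B.scaleR_right
          power2_eq_square algebra_simps)
  qed
  then show ?thesis by blast
qed

lemma expansionD:
  assumes "second_order_expansion g x0 D Q"
  shows "bounded_linear D" "Q (r *\<^sub>R a) = r\<^sup>2 *\<^sub>R Q a"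
    "(v \<longlongrightarrow> 0) (at_right 0) \<Longrightarrow> O_pow 0 (\<lambda>h. g (x0 + v h))"
    "O_pow 1 v \<Longrightarrow> O_pow 1 (\<lambda>h. g (x0 + v h) - g x0)"
    "O_pow 2 (\<lambda>h. v h - h *\<^sub>R a) \<Longrightarrow> O_pow 2 (\<lambda>h. g (x0 + v h) - g x0 - h *\<^sub>R D a)"
    "O_pow 3 (\<lambda>h. v h - h *\<^sub>R a - h\<^sup>2 *\<^sub>R w) \<Longrightarrow>
       O_pow 3 (\<lambda>h. g (x0 + v h) - g x0 - h *\<^sub>R D a - h\<^sup>2 *\<^sub>R (D w + Q a))"
  using assms unfolding second_order_expansion_def by blast+

text \<open>A Picard-like bootstrap in the extended phase space: what is known about
  \<open>(h, u h)\<close> passes through the expansion of the right-hand side to \<open>u'\<close>,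
  and integration returns it with one order more. Continuity of \<open>y\<close> at
  \<open>t0\<close> starts the process.\<close>

lemma O_pow_exact_solution:
  fixes f :: "'s \<Rightarrow> real \<Rightarrow> 'a::real_normed_vector \<Rightarrow> 'a"
  assumes ex: "\<And>\<sigma>. \<sigma> \<in> P \<Longrightarrow> second_order_expansion (\<lambda>(t, x). f \<sigma> t x) (t0, y0) (D \<sigma>) (Q \<sigma>)"
    and "\<delta> > 0" "y t0 = y0"
    and der: "\<forall>t\<in>{t0..t0+\<delta>}.
          (y has_vector_derivative (\<Sum>\<sigma>\<in>P. f \<sigma> t (y t))) (at t within {t0..t0+\<delta>})"
    and F0: "F0 = (\<Sum>\<sigma>\<in>P. f \<sigma> t0 y0)"
    and Z: "Z = (\<Sum>\<sigma>\<in>P. D \<sigma> (1, F0))"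
  shows "O_pow 4 (\<lambda>h. y (t0 + h) - y0 - h *\<^sub>R F0 - h\<^sup>2 *\<^sub>R (1/2) *\<^sub>R Z
    - h ^ 3 *\<^sub>R (\<Sum>\<sigma>\<in>P. (1/6) *\<^sub>R D \<sigma> (0, Z) + (1/3) *\<^sub>R Q \<sigma> (1, F0)))"
proof -
  define u where "u h = y (t0 + h) - y0" for h
  define g where "g \<sigma> = (\<lambda>(t, x). f \<sigma> t x)" for \<sigma>
  define u' where "u' h = (\<Sum>\<sigma>\<in>P. g \<sigma> ((t0, y0) + (h, u h)))" for h
  note ex = ex[folded g_def]
  have gf: "g \<sigma> (t0, y0) = f \<sigma> t0 y0" for \<sigma> by (simp add: g_def)
  have u0: "u 0 = 0" using assms by (simp add: u_def)
  have u': "(u has_vector_derivative u' h) (at h within {0..\<delta>})" if h: "h \<in> {0..\<delta>}" for h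
  proof -
    have "(y has_vector_derivative (\<Sum>\<sigma>\<in>P. f \<sigma> (t0 + h) (y (t0 + h))))
        (at (t0 + h) within (\<lambda>h. t0 + h) ` {0..\<delta>})"
      using der h by (simp add: add.commute)
    moreover have "((\<lambda>h. t0 + h) has_vector_derivative 1) (at h within {0..\<delta>})"
      by (auto intro!: derivative_eq_intros)
    ultimately have "((y \<circ> (\<lambda>h. t0 + h)) has_vector_derivative
        1 *\<^sub>R (\<Sum>\<sigma>\<in>P. f \<sigma> (t0 + h) (y (t0 + h)))) (at h within {0..\<delta>})"
      by (intro vector_diff_chain_within)
    then have "(u has_vector_derivative (1 *\<^sub>R (\<Sum>\<sigma>\<in>P. f \<sigma> (t0 + h) (y (t0 + h)))) - 0) (at h within {0..\<delta>})"
      unfolding u_def o_def by (rule has_vector_derivative_diff) simp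
    then show ?thesis by (simp add: u'_def g_def u_def)
  qed
  have u_lim: "(u \<longlongrightarrow> 0) (at_right 0)"
  proof -
    have "continuous (at 0 within {0..\<delta>}) u"
      using u'[of 0] \<open>\<delta> > 0\<close> has_vector_derivative_continuous by fastforce
    then show ?thesis
      using at_within_Icc_at_right[OF \<open>\<delta> > 0\<close>] u0 by (simp add: continuous_within)
  qed
  have id_lim: "((\<lambda>h::real. h) \<longlongrightarrow> 0) (at_right 0)" by (rule tendsto_ident_at)
  have "O_pow 0 u'"
    unfolding u'_def
    by (intro O_pow_sum expansionD(3)[OF ex] tendsto_eq_intros(1))
      (use tendsto_Pair[OF id_lim u_lim] in \<open>simp_all add: zero_prod_def\<close>)
  then have "O_pow (Suc 0) u" by (intro O_pow_integrate[OF \<open>\<delta> > 0\<close> u0 u'])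
  then have u1: "O_pow 1 (\<lambda>h. (h, u h))"
    using O_pow_power[of 1 "1::real"] by (intro O_pow_Pair) simp_all
  have "O_pow 1 (\<lambda>h. \<Sum>\<sigma>\<in>P. g \<sigma> ((t0, y0) + (h, u h)) - g \<sigma> (t0, y0))"
    by (intro O_pow_sum expansionD(4)[OF ex u1])
  then have "O_pow 1 (\<lambda>h. u' h - F0)"
    by (rule O_pow_cong) (simp add: u'_def F0 gf sum_subtractf)
  then have "O_pow (Suc 1) (\<lambda>h. u h - h *\<^sub>R F0)"
    by (intro O_pow_integrate[OF \<open>\<delta> > 0\<close>, where u' = "\<lambda>h. u' h - F0"])
      (auto intro!: derivative_eq_intros u' simp: u0)
  then have u2: "O_pow 2 (\<lambda>h. (h, u h) - h *\<^sub>R (1, F0))"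
    by (simp add: numeral_2_eq_2 O_pow_Pair)
  have "O_pow 2 (\<lambda>h. \<Sum>\<sigma>\<in>P. g \<sigma> ((t0, y0) + (h, u h)) - g \<sigma> (t0, y0) - h *\<^sub>R D \<sigma> (1, F0))"
    by (intro O_pow_sum expansionD(5)[OF ex u2])
  then have "O_pow 2 (\<lambda>h. u' h - F0 - h *\<^sub>R Z)"
    by (rule O_pow_cong) (simp add: u'_def F0 Z gf sum_subtractf scaleR_sum_right)
  then have "O_pow (Suc 2) (\<lambda>h. u h - h *\<^sub>R F0 - h\<^sup>2 *\<^sub>R (1/2) *\<^sub>R Z)"
    by (intro O_pow_integrate[OF \<open>\<delta> > 0\<close>, where u' = "\<lambda>h. u' h - F0 - h *\<^sub>R Z"])
      (auto intro!: derivative_eq_intros u' simp: u0)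
  then have u3: "O_pow 3 (\<lambda>h. (h, u h) - h *\<^sub>R (1, F0) - h\<^sup>2 *\<^sub>R (0, (1/2) *\<^sub>R Z))"
    by (simp add: numeral_3_eq_3 numeral_2_eq_2 O_pow_Pair)
  \<comment> \<open>\<open>X\<close> is the \<open>h^2\<close> coefficient of \<open>u'\<close>. Its
    1/2 comes from integrating \<open>h Z\<close>; integrating \<open>h^2 X\<close> brings a factor
    1/3, hence the 1/6 and 1/3 of the claim.\<close>
  define X where "X = (\<Sum>\<sigma>\<in>P. D \<sigma> (0, (1/2) *\<^sub>R Z) + Q \<sigma> (1, F0))"
  have "O_pow 3 (\<lambda>h. \<Sum>\<sigma>\<in>P. g \<sigma> ((t0, y0) + (h, u h)) - g \<sigma> (t0, y0) - h *\<^sub>R D \<sigma> (1, F0)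
      - h\<^sup>2 *\<^sub>R (D \<sigma> (0, (1/2) *\<^sub>R Z) + Q \<sigma> (1, F0)))"
    by (intro O_pow_sum expansionD(6)[OF ex u3])
  then have "O_pow 3 (\<lambda>h. u' h - F0 - h *\<^sub>R Z - h\<^sup>2 *\<^sub>R X)"
    by (rule O_pow_cong) (simp add: u'_def F0 Z X_def gf sum_subtractf scaleR_sum_right)
  then have "O_pow (Suc 3) (\<lambda>h. u h - h *\<^sub>R F0 - h\<^sup>2 *\<^sub>R (1/2) *\<^sub>R Z - h ^ 3 *\<^sub>R (1/3) *\<^sub>R X)"
    by (intro O_pow_integrate[OF \<open>\<delta> > 0\<close>, where u' = "\<lambda>h. u' h - F0 - h *\<^sub>R Z - h\<^sup>2 *\<^sub>R X"])
      (auto intro!: derivative_eq_intros u' simp: u0)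
  moreover have "(1/3) *\<^sub>R X = (\<Sum>\<sigma>\<in>P. (1/6) *\<^sub>R D \<sigma> (0, Z) + (1/3) *\<^sub>R Q \<sigma> (1, F0))"
    unfolding X_def scaleR_sum_right
  proof (rule sum.cong)
    fix \<sigma> assume "\<sigma> \<in> P"
    then interpret D: bounded_linear "D \<sigma>" by (intro expansionD(1)[OF ex])
    have "D \<sigma> (0, (1/2) *\<^sub>R Z) = (1/2) *\<^sub>R D \<sigma> (0, Z)" using D.scaleR[of "1/2" "(0, Z)"] by simp
    then show "(1/3) *\<^sub>R (D \<sigma> (0, (1/2) *\<^sub>R Z) + Q \<sigma> (1, F0)) =
      (1/6) *\<^sub>R D \<sigma> (0, Z) + (1/3) *\<^sub>R Q \<sigma> (1, F0)" by (simp add: scaleR_add_right)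
  qed simp
  ultimately show ?thesis by (simp add: u_def)
qed

section \<open>Order three for internally consistent additive schemes\<close>

text \<open>
  A generalized-structure additive Runge-Kutta scheme in which all components share one stage set and
  one node vector \<open>d\<close>; a component that is not evaluated at a stage has zero coefficients there.
\<close>

definition gark_step ::
  "'s set \<Rightarrow> 'i set \<Rightarrow> ('s \<Rightarrow> 'i \<Rightarrow> 'i \<Rightarrow> real) \<Rightarrow> ('s \<Rightarrow> 'i \<Rightarrow> real) \<Rightarrow> ('i \<Rightarrow> real) \<Rightarrow>
   ('s \<Rightarrow> real \<Rightarrow> 'a \<Rightarrow> 'a) \<Rightarrow> real \<Rightarrow> 'a \<Rightarrow> real \<Rightarrow> ('i \<Rightarrow> 'a) \<Rightarrow> 'a::real_vector \<Rightarrow> bool" where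
  "gark_step P S A b d f t0 y0 H Y y1 \<longleftrightarrow>
     (\<forall>i\<in>S. Y i = y0 + H *\<^sub>R (\<Sum>\<sigma>\<in>P. \<Sum>j\<in>S. A \<sigma> i j *\<^sub>R f \<sigma> (t0 + d j * H) (Y j))) \<and>
     y1 = y0 + H *\<^sub>R (\<Sum>\<sigma>\<in>P. \<Sum>j\<in>S. b \<sigma> j *\<^sub>R f \<sigma> (t0 + d j * H) (Y j))"

definition gark_order_conditions ::
  "'s set \<Rightarrow> 'i set \<Rightarrow> ('s \<Rightarrow> 'i \<Rightarrow> 'i \<Rightarrow> real) \<Rightarrow> ('s \<Rightarrow> 'i \<Rightarrow> real) \<Rightarrow> ('i \<Rightarrow> real) \<Rightarrow> bool" where
  "gark_order_conditions P S A b d \<longleftrightarrow>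
     (\<forall>\<sigma>\<in>P. (\<Sum>j\<in>S. b \<sigma> j) = 1 \<and> (\<Sum>j\<in>S. b \<sigma> j * d j) = 1/2 \<and> (\<Sum>j\<in>S. b \<sigma> j * (d j)\<^sup>2) = 1/3 \<and>
       (\<forall>\<tau>\<in>P. (\<Sum>i\<in>S. b \<sigma> i * (\<Sum>j\<in>S. A \<tau> i j * d j)) = 1/6))"

text \<open>The same bootstrap, with the factor \<open>H\<close> of the stage equations in place of
  integration. The row sums make the first-order term of stage \<open>j\<close> equal to
  \<open>d j\<close> times \<open>(1, F0)\<close>, in time and state alike; the order conditions
  then turn the weighted sums into the coefficients of the exact solution.\<close>

lemma O_pow_gark_solution:
  fixes f :: "'s \<Rightarrow> real \<Rightarrow> 'a::real_normed_vector \<Rightarrow> 'a"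
  assumes ex: "\<And>\<sigma>. \<sigma> \<in> P \<Longrightarrow> second_order_expansion (\<lambda>(t, x). f \<sigma> t x) (t0, y0) (D \<sigma>) (Q \<sigma>)"
    and rows: "\<And>\<sigma> i. \<sigma> \<in> P \<Longrightarrow> i \<in> S \<Longrightarrow> (\<Sum>j\<in>S. A \<sigma> i j) = d i"
    and cond: "gark_order_conditions P S A b d"
    and step: "\<forall>\<^sub>F H in at_right 0. gark_step P S A b d f t0 y0 H (Y H) (y1 H)"
    and lim: "\<forall>i\<in>S. ((\<lambda>H. Y H i) \<longlongrightarrow> y0) (at_right 0)"
    and F0: "F0 = (\<Sum>\<sigma>\<in>P. f \<sigma> t0 y0)"
    and Z: "Z = (\<Sum>\<sigma>\<in>P. D \<sigma> (1, F0))"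
  shows "O_pow 4 (\<lambda>H. y1 H - y0 - H *\<^sub>R F0 - H\<^sup>2 *\<^sub>R (1/2) *\<^sub>R Z
    - H ^ 3 *\<^sub>R (\<Sum>\<sigma>\<in>P. (1/6) *\<^sub>R D \<sigma> (0, Z) + (1/3) *\<^sub>R Q \<sigma> (1, F0)))"
proof -
  define u where "u i H = Y H i - y0" for i H
  define g where "g \<sigma> = (\<lambda>(t, x). f \<sigma> t x)" for \<sigma>
  define v where "v i H = (d i * H, u i H)" for i H
  note ex = ex[folded g_def]
  have gf: "g \<sigma> (t0, y0) = f \<sigma> t0 y0" for \<sigma> by (simp add: g_def)
  have fg: "f \<sigma> (t0 + d j * H) (Y H j) = g \<sigma> ((t0, y0) + v j H)" for \<sigma> j H
    by (simp add: g_def v_def u_def)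
  have u_ev: "\<forall>\<^sub>F H in at_right 0.
      u i H = H *\<^sub>R (\<Sum>\<sigma>\<in>P. \<Sum>j\<in>S. A \<sigma> i j *\<^sub>R g \<sigma> ((t0, y0) + v j H))" if "i \<in> S" for i
    using step by eventually_elim (use that in \<open>auto simp: gark_step_def fg u_def\<close>)
  have y1_ev: "\<forall>\<^sub>F H in at_right 0.
      y1 H = y0 + H *\<^sub>R (\<Sum>\<sigma>\<in>P. \<Sum>j\<in>S. b \<sigma> j *\<^sub>R g \<sigma> ((t0, y0) + v j H))"
    using step by eventually_elim (auto simp: gark_step_def fg)
  have v_lim: "(v i \<longlongrightarrow> 0) (at_right 0)" if "i \<in> S" for i
  proof -
    have "((\<lambda>H. (d i * H, Y H i - y0)) \<longlongrightarrow> (d i * 0, y0 - y0)) (at_right 0)"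
      using lim that by (intro tendsto_intros) auto
    then show ?thesis unfolding v_def u_def zero_prod_def by simp
  qed
  have "O_pow (Suc 0) (u i)" if i: "i \<in> S" for i
  proof (rule O_pow_cong_ev[OF _ u_ev[OF i]])
    show "O_pow (Suc 0) (\<lambda>H. H *\<^sub>R (\<Sum>\<sigma>\<in>P. \<Sum>j\<in>S. A \<sigma> i j *\<^sub>R g \<sigma> ((t0, y0) + v j H)))"
      by (intro O_pow_Suc_scaleR O_pow_sum O_pow_scaleR expansionD(3)[OF ex] v_lim)
  qed
  then have v1: "O_pow 1 (v i)" if "i \<in> S" for i
    using O_pow_power[of 1 "d i"] that unfolding v_def by (intro O_pow_Pair) (simp_all add: mult.commute)
  have "O_pow (Suc 1) (\<lambda>H. u i H - H *\<^sub>R d i *\<^sub>R F0)" if i: "i \<in> S" for i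
  proof (rule O_pow_cong_ev)
    show "O_pow (Suc 1) (\<lambda>H. H *\<^sub>R (\<Sum>\<sigma>\<in>P. \<Sum>j\<in>S. A \<sigma> i j *\<^sub>R (g \<sigma> ((t0, y0) + v j H) - g \<sigma> (t0, y0))))"
      by (intro O_pow_Suc_scaleR O_pow_sum O_pow_scaleR expansionD(4)[OF ex] v1)
    have d: "d i *\<^sub>R F0 = (\<Sum>\<sigma>\<in>P. \<Sum>j\<in>S. A \<sigma> i j *\<^sub>R g \<sigma> (t0, y0))"
      using rows[OF _ i] by (simp add: F0 gf scaleR_sum_right scaleR_sum_left[symmetric])
    show "\<forall>\<^sub>F H in at_right 0. u i H - H *\<^sub>R d i *\<^sub>R F0 =
        H *\<^sub>R (\<Sum>\<sigma>\<in>P. \<Sum>j\<in>S. A \<sigma> i j *\<^sub>R (g \<sigma> ((t0, y0) + v j H) - g \<sigma> (t0, y0)))"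
      using u_ev[OF i] by eventually_elim
        (simp add: d scaleR_diff_right sum_subtractf)
  qed
  then have v2: "O_pow 2 (\<lambda>H. v i H - H *\<^sub>R d i *\<^sub>R (1, F0))" if "i \<in> S" for i
    using that unfolding v_def by (simp add: numeral_2_eq_2 O_pow_Pair mult.commute)
  have D: "D \<sigma> (r *\<^sub>R x) = r *\<^sub>R D \<sigma> x" if "\<sigma> \<in> P" for \<sigma> r x
    using expansionD(1)[OF ex[OF that]] by (rule linear_simps)
  \<comment> \<open>\<open>W i\<close>, built from these, is the \<open>H^2\<close> coefficient of
    stage \<open>i\<close>, the counterpart of \<open>Z / 2\<close> in the exact solution.\<close>
  define a where "a \<sigma> i = (\<Sum>j\<in>S. A \<sigma> i j * d j)" for \<sigma> i
  define W where "W i = (\<Sum>\<sigma>\<in>P. a \<sigma> i *\<^sub>R D \<sigma> (1, F0))" for i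
  have "O_pow (Suc 2) (\<lambda>H. u i H - H *\<^sub>R d i *\<^sub>R F0 - H\<^sup>2 *\<^sub>R W i)" if i: "i \<in> S" for i
  proof (rule O_pow_cong_ev)
    show "O_pow (Suc 2) (\<lambda>H. H *\<^sub>R (\<Sum>\<sigma>\<in>P. \<Sum>j\<in>S. A \<sigma> i j *\<^sub>R
        (g \<sigma> ((t0, y0) + v j H) - g \<sigma> (t0, y0) - H *\<^sub>R D \<sigma> (d j *\<^sub>R (1, F0)))))"
      by (intro O_pow_Suc_scaleR O_pow_sum O_pow_scaleR expansionD(5)[OF ex] v2)
    have d: "d i *\<^sub>R F0 = (\<Sum>\<sigma>\<in>P. \<Sum>j\<in>S. A \<sigma> i j *\<^sub>R g \<sigma> (t0, y0))"
      using rows[OF _ i] by (simp add: F0 gf scaleR_sum_right scaleR_sum_left[symmetric])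
    have W: "H *\<^sub>R W i = (\<Sum>\<sigma>\<in>P. \<Sum>j\<in>S. A \<sigma> i j *\<^sub>R H *\<^sub>R D \<sigma> (d j *\<^sub>R (1, F0)))" for H
      by (simp add: W_def a_def D scaleR_sum_left scaleR_sum_right mult_ac del: scaleR_Pair)
    show "\<forall>\<^sub>F H in at_right 0. u i H - H *\<^sub>R d i *\<^sub>R F0 - H\<^sup>2 *\<^sub>R W i = H *\<^sub>R (\<Sum>\<sigma>\<in>P. \<Sum>j\<in>S. A \<sigma> i j *\<^sub>R
        (g \<sigma> ((t0, y0) + v j H) - g \<sigma> (t0, y0) - H *\<^sub>R D \<sigma> (d j *\<^sub>R (1, F0))))"
      using u_ev[OF i] unfolding power2_eq_square scaleR_scaleR[symmetric] W d
      by eventually_elim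
        (simp add: scaleR_diff_right sum_subtractf scaleR_sum_right mult_ac del: scaleR_Pair)
  qed
  then have v3: "O_pow 3 (\<lambda>H. v i H - H *\<^sub>R d i *\<^sub>R (1, F0) - H\<^sup>2 *\<^sub>R (0, W i))" if "i \<in> S" for i
    using that unfolding v_def by (simp add: numeral_3_eq_3 numeral_2_eq_2 O_pow_Pair mult.commute)
  have cond: "(\<Sum>j\<in>S. b \<sigma> j) = 1" "(\<Sum>j\<in>S. b \<sigma> j * d j) = 1/2" "(\<Sum>j\<in>S. b \<sigma> j * (d j)\<^sup>2) = 1/3"
      "\<tau> \<in> P \<Longrightarrow> (\<Sum>i\<in>S. b \<sigma> i * a \<tau> i) = 1/6" if "\<sigma> \<in> P" for \<sigma> \<tau>
    using cond that unfolding gark_order_conditions_def a_def by blast+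
  have "O_pow (Suc 3) (\<lambda>H. y1 H - y0 - H *\<^sub>R F0 - H\<^sup>2 *\<^sub>R (1/2) *\<^sub>R Z
    - H ^ 3 *\<^sub>R (\<Sum>\<sigma>\<in>P. (1/6) *\<^sub>R D \<sigma> (0, Z) + (1/3) *\<^sub>R Q \<sigma> (1, F0)))"
  proof (rule O_pow_cong_ev)
    show "O_pow (Suc 3) (\<lambda>H. H *\<^sub>R (\<Sum>\<sigma>\<in>P. \<Sum>j\<in>S. b \<sigma> j *\<^sub>R
        (g \<sigma> ((t0, y0) + v j H) - g \<sigma> (t0, y0) - H *\<^sub>R D \<sigma> (d j *\<^sub>R (1, F0))
          - H\<^sup>2 *\<^sub>R (D \<sigma> (0, W j) + Q \<sigma> (d j *\<^sub>R (1, F0))))))"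
      by (intro O_pow_Suc_scaleR O_pow_sum O_pow_scaleR expansionD(6)[OF ex] v3)
    have 1: "F0 = (\<Sum>\<sigma>\<in>P. \<Sum>j\<in>S. b \<sigma> j *\<^sub>R g \<sigma> (t0, y0))"
      using cond(1) by (simp add: F0 gf scaleR_sum_left[symmetric])
    have 2: "H *\<^sub>R (1/2) *\<^sub>R Z = (\<Sum>\<sigma>\<in>P. \<Sum>j\<in>S. b \<sigma> j *\<^sub>R H *\<^sub>R D \<sigma> (d j *\<^sub>R (1, F0)))" for H
    proof -
      have "(\<Sum>j\<in>S. b \<sigma> j *\<^sub>R H *\<^sub>R D \<sigma> (d j *\<^sub>R (1, F0))) = H *\<^sub>R (1/2) *\<^sub>R D \<sigma> (1, F0)"
        if "\<sigma> \<in> P" for \<sigma>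
        unfolding cond(2)[OF that, symmetric] D[OF that]
        by (simp add: scaleR_sum_left scaleR_sum_right mult_ac)
      then show ?thesis by (simp add: Z scaleR_sum_right del: scaleR_Pair)
    qed
    have 3: "(\<Sum>j\<in>S. b \<sigma> j *\<^sub>R H\<^sup>2 *\<^sub>R (D \<sigma> (0, W j) + Q \<sigma> (d j *\<^sub>R (1, F0))))
        = H\<^sup>2 *\<^sub>R ((1/6) *\<^sub>R D \<sigma> (0, Z) + (1/3) *\<^sub>R Q \<sigma> (1, F0))" if s: "\<sigma> \<in> P" for \<sigma> H
    proof -
      interpret D: bounded_linear "D \<sigma>" by (rule expansionD(1)[OF ex[OF s]])
      \<comment> \<open>The coupling conditions for all \<open>\<tau>\<close> act at once: the
        weighted second-order stage terms add up to \<open>Z / 6\<close>, and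
        \<open>D \<sigma>\<close> is linear.\<close>
      have "(\<Sum>j\<in>S. b \<sigma> j *\<^sub>R W j) = (\<Sum>\<tau>\<in>P. (\<Sum>j\<in>S. b \<sigma> j * a \<tau> j) *\<^sub>R D \<tau> (1, F0))"
        unfolding W_def scaleR_sum_left scaleR_sum_right by (subst sum.swap) simp
      also have "\<dots> = (1/6) *\<^sub>R Z" by (simp add: cond(4)[OF s] Z scaleR_sum_right)
      finally have "(\<Sum>j\<in>S. b \<sigma> j *\<^sub>R (0::real, W j)) = (1/6) *\<^sub>R (0, Z)"
        by (simp add: prod_eq_iff fst_sum snd_sum)
      then have "(\<Sum>j\<in>S. b \<sigma> j *\<^sub>R D \<sigma> (0, W j)) = (1/6) *\<^sub>R D \<sigma> (0, Z)"
        unfolding D.scaleR[symmetric] D.sum[symmetric] by simp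
      moreover have "(\<Sum>j\<in>S. b \<sigma> j *\<^sub>R Q \<sigma> (d j *\<^sub>R (1, F0))) = (1/3) *\<^sub>R Q \<sigma> (1, F0)"
        unfolding expansionD(2)[OF ex[OF s]] cond(3)[OF s, symmetric] by (simp add: scaleR_sum_left)
      moreover have "(\<Sum>j\<in>S. b \<sigma> j *\<^sub>R H\<^sup>2 *\<^sub>R (D \<sigma> (0, W j) + Q \<sigma> (d j *\<^sub>R (1, F0))))
        = H\<^sup>2 *\<^sub>R ((\<Sum>j\<in>S. b \<sigma> j *\<^sub>R D \<sigma> (0, W j)) + (\<Sum>j\<in>S. b \<sigma> j *\<^sub>R Q \<sigma> (d j *\<^sub>R (1, F0))))"
        by (simp add: scaleR_sum_right scaleR_add_right sum.distrib mult_ac del: scaleR_Pair)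
      ultimately show ?thesis by simp
    qed
    show "\<forall>\<^sub>F H in at_right 0. y1 H - y0 - H *\<^sub>R F0 - H\<^sup>2 *\<^sub>R (1/2) *\<^sub>R Z
      - H ^ 3 *\<^sub>R (\<Sum>\<sigma>\<in>P. (1/6) *\<^sub>R D \<sigma> (0, Z) + (1/3) *\<^sub>R Q \<sigma> (1, F0)) =
      H *\<^sub>R (\<Sum>\<sigma>\<in>P. \<Sum>j\<in>S. b \<sigma> j *\<^sub>R
        (g \<sigma> ((t0, y0) + v j H) - g \<sigma> (t0, y0) - H *\<^sub>R D \<sigma> (d j *\<^sub>R (1, F0))
          - H\<^sup>2 *\<^sub>R (D \<sigma> (0, W j) + Q \<sigma> (d j *\<^sub>R (1, F0)))))"
      using y1_ev
    proof eventually_elim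
      case (elim H)
      define X where "X = (\<Sum>\<sigma>\<in>P. (1/6) *\<^sub>R D \<sigma> (0, Z) + (1/3) *\<^sub>R Q \<sigma> (1, F0))"
      have eq: "(\<Sum>\<sigma>\<in>P. \<Sum>j\<in>S. b \<sigma> j *\<^sub>R
        (g \<sigma> ((t0, y0) + v j H) - g \<sigma> (t0, y0) - H *\<^sub>R D \<sigma> (d j *\<^sub>R (1, F0))
          - H\<^sup>2 *\<^sub>R (D \<sigma> (0, W j) + Q \<sigma> (d j *\<^sub>R (1, F0))))) =
        (\<Sum>\<sigma>\<in>P. \<Sum>j\<in>S. b \<sigma> j *\<^sub>R g \<sigma> ((t0, y0) + v j H)) - F0 - H *\<^sub>R (1/2) *\<^sub>R Z - H\<^sup>2 *\<^sub>R X"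
        unfolding scaleR_diff_right sum_subtractf 1[symmetric] 2[symmetric]
        by (simp add: 3 X_def scaleR_sum_right del: scaleR_Pair scaleR_scaleR cong: sum.cong)
      show ?case unfolding elim X_def[symmetric] eq
        by (simp add: algebra_simps power2_eq_square power3_eq_cube)
    qed
  qed
  then show ?thesis by simp
qed

lemma gark_conditions_imp_order:
  fixes P :: "component set"
  assumes rows: "\<And>\<sigma> i. \<sigma> \<in> P \<Longrightarrow> i \<in> S \<Longrightarrow> (\<Sum>j\<in>S. A \<sigma> i j) = d i"
    and cond: "gark_order_conditions P S A b d"
  shows "has_order P S (gark_step P S A b d) 3 TYPE('a::euclidean_space)"
  unfolding has_order_def
proof (intro exI[of _ 3] allI impI)
  fix f :: "component \<Rightarrow> real \<Rightarrow> 'a \<Rightarrow> 'a" and t0 y0 \<delta> y Y y1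
  assume C: "\<forall>\<sigma>\<in>P. C_k 3 (\<lambda>(t, x). f \<sigma> t x)"
    and *: "\<delta> > 0" "y t0 = y0" "\<forall>t\<in>{t0..t0+\<delta>}.
          (y has_vector_derivative (\<Sum>\<sigma>\<in>P. f \<sigma> t (y t))) (at t within {t0..t0+\<delta>})"
    and **: "\<forall>\<^sub>F H in at_right 0. gark_step P S A b d f t0 y0 H (Y H) (y1 H)"
      "\<forall>i\<in>S. ((\<lambda>H. Y H i) \<longlongrightarrow> y0) (at_right 0)"
  have "\<forall>\<sigma>. \<exists>D Q. \<sigma> \<in> P \<longrightarrow> second_order_expansion (\<lambda>(t, x). f \<sigma> t x) (t0, y0) D Q"
    using C C_3_second_order_expansion by blast
  then obtain D Q where
    ex: "\<And>\<sigma>. \<sigma> \<in> P \<Longrightarrow> second_order_expansion (\<lambda>(t, x). f \<sigma> t x) (t0, y0) (D \<sigma>) (Q \<sigma>)"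
    by metis
  \<comment> \<open>Both expansions have the same polynomial part up to \<open>H^3\<close>, which
    cancels in the difference.\<close>
  have "O_pow 4 (\<lambda>H. y1 H - y (t0 + H))"
    by (rule O_pow_cong[OF O_pow_diff[OF O_pow_gark_solution[OF ex rows cond ** refl refl]
      O_pow_exact_solution[OF ex * refl refl]]]) simp_all
  then show "(\<lambda>H. norm (y1 H - y (t0 + H))) \<in> O[at_right 0](\<lambda>H. H ^ (3 + 1))"
    by (simp add: O_pow_iff_bigo)
qed

section \<open>Test problems and the necessity of the order conditions\<close>

lemma C_k_const: "C_k k (\<lambda>x. a)"
  by (induction k arbitrary: a) (auto simp: frechet_derivative_const)

lemma C_k_bounded_linear:
  assumes "bounded_linear T"
  shows "C_k k T"
proof (cases k)
  case 0
  then show ?thesis using assms by (simp add: linear_continuous_on)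
next
  case (Suc n)
  have d: "(T has_derivative T) (at x)" for x by (rule bounded_linear_imp_has_derivative[OF assms])
  then have "frechet_derivative T (at x) = T" for x by (rule frechet_derivative_at[symmetric])
  then show ?thesis using d by (auto simp: Suc C_k_const differentiable_def)
qed

text \<open>The smoothness threshold in \<open>has_order\<close> is unknown, so a test problem must
  be \<open>C_k\<close> for every \<open>k\<close>. The scalar \<open>r\<close> closes the family
  under differentiation; at \<open>m = 0\<close> the truncated \<open>m - 1\<close> is harmless
  because the factor \<open>m\<close> is 0.\<close>

lemma C_k_monomial:
  fixes e :: "'c::real_normed_vector"
  shows "C_k k (\<lambda>(t::real, x::'b::real_normed_vector). (r * t ^ m) *\<^sub>R e)"
proof (induction k arbitrary: r m)
  case 0
  show ?case by (auto simp: split_beta intro!: continuous_intros)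
next
  case (Suc k)
  have d: "((\<lambda>(t::real, x::'b). (r * t ^ m) *\<^sub>R e) has_derivative
      (\<lambda>v. (r * m * fst v * fst p ^ (m - 1)) *\<^sub>R e)) (at p)" for p
    unfolding split_beta
    by (auto intro!: derivative_eq_intros simp: mult_ac)
  have "frechet_derivative (\<lambda>(t::real, x::'b). (r * t ^ m) *\<^sub>R e) (at p) =
      (\<lambda>v. (r * m * fst v * fst p ^ (m - 1)) *\<^sub>R e)" for p
    by (rule frechet_derivative_at[OF d, symmetric])
  moreover have "C_k k (\<lambda>p :: real \<times> 'b. (r * m * fst v * fst p ^ (m - 1)) *\<^sub>R e)" for v :: "real \<times> 'b"
    using Suc.IH[of "r * m * fst v" "m - 1"] by (simp add: split_beta)
  moreover have "(\<lambda>(t::real, x::'b). (r * t ^ m) *\<^sub>R e) differentiable (at p)" for p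
    using d unfolding differentiable_def by blast
  ultimately show ?case by simp
qed

lemma sum_only:
  fixes X :: "'s \<Rightarrow> 'i \<Rightarrow> 'a::real_vector"
  assumes "finite P" "\<sigma> \<in> P"
  shows "(\<Sum>\<rho>\<in>P. \<Sum>j\<in>S. r \<rho> j *\<^sub>R (if \<rho> = \<sigma> then X \<rho> j else 0)) = (\<Sum>j\<in>S. r \<sigma> j *\<^sub>R X \<sigma> j)"
proof -
  have "(\<Sum>\<rho>\<in>P. \<Sum>j\<in>S. r \<rho> j *\<^sub>R (if \<rho> = \<sigma> then X \<rho> j else 0)) =
      (\<Sum>\<rho>\<in>P. if \<rho> = \<sigma> then (\<Sum>j\<in>S. r \<rho> j *\<^sub>R X \<rho> j) else 0)"
    by (rule sum.cong) auto
  then show ?thesis using assms by simp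
qed

text \<open>Test problem \<open>y' = t^m e\<close>, carried by \<open>\<sigma>\<close> alone:
  nothing depends on the state, so the stages are explicit, and at \<open>H^(m+1)\<close> the
  weighted sum must match the exact \<open>1 / (m + 1)\<close>. The bound \<open>m \<le> 2\<close>
  keeps this power within order three.\<close>

lemma gark_order_imp_quadrature:
  fixes P :: "component set"
  assumes ord: "has_order P S (gark_step P S A b d) 3 TYPE('a::euclidean_space)"
    and P: "finite P" "\<sigma> \<in> P" and m: "m \<le> 2"
  shows "(\<Sum>j\<in>S. b \<sigma> j * d j ^ m) = 1 / real (Suc m)"
proof -
  obtain e :: 'a where e: "e \<noteq> 0" using SOME_Basis nonzero_Basis by blast
  define f where "f \<rho> t x = (if \<rho> = \<sigma> then t ^ m *\<^sub>R e else 0)" for \<rho> t and x :: 'a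
  define y where "y t = (t ^ Suc m / real (Suc m)) *\<^sub>R e" for t
  define Y where "Y H i = (H ^ Suc m * (\<Sum>j\<in>S. A \<sigma> i j * d j ^ m)) *\<^sub>R e" for H i
  define y1 where "y1 H = (H ^ Suc m * (\<Sum>j\<in>S. b \<sigma> j * d j ^ m)) *\<^sub>R e" for H
  have f_sum: "(\<Sum>\<rho>\<in>P. \<Sum>j\<in>S. r \<rho> j *\<^sub>R f \<rho> (0 + d j * H) (X j)) = (H ^ m * (\<Sum>j\<in>S. r \<sigma> j * d j ^ m)) *\<^sub>R e"
    for r :: "component \<Rightarrow> _ \<Rightarrow> real" and H X
    unfolding f_def sum_only[OF P]
    by (simp add: sum_distrib_left scaleR_sum_left power_mult_distrib mult_ac)
  obtain k where k: "\<And>(f :: component \<Rightarrow> real \<Rightarrow> 'a \<Rightarrow> 'a) t0 y0 \<delta> y Y y1.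
       (\<forall>\<sigma>\<in>P. C_k k (\<lambda>(t, x). f \<sigma> t x)) \<Longrightarrow> \<delta> > 0 \<Longrightarrow> y t0 = y0 \<Longrightarrow>
       (\<forall>t\<in>{t0..t0+\<delta>}.
          (y has_vector_derivative (\<Sum>\<sigma>\<in>P. f \<sigma> t (y t))) (at t within {t0..t0+\<delta>})) \<Longrightarrow>
       (\<forall>\<^sub>F H in at_right 0. gark_step P S A b d f t0 y0 H (Y H) (y1 H)) \<Longrightarrow>
       (\<forall>i\<in>S. ((\<lambda>H. Y H i) \<longlongrightarrow> y0) (at_right 0)) \<Longrightarrow>
       (\<lambda>H. norm (y1 H - y (t0 + H))) \<in> O[at_right 0](\<lambda>H. H ^ (3 + 1))"
    using ord unfolding has_order_def by blast
  have "(\<lambda>H. norm (y1 H - y (0 + H))) \<in> O[at_right 0](\<lambda>H. H ^ (3 + 1))"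
  proof (rule k[of f 1 y 0 0 Y y1])
    show "\<forall>\<sigma>\<in>P. C_k k (\<lambda>(t, x). f \<sigma> t x)"
    proof
      fix \<rho> show "C_k k (\<lambda>(t, x). f \<rho> t x)"
        using C_k_monomial[of k "if \<rho> = \<sigma> then 1 else 0" m e, where 'b = 'a]
        by (simp add: f_def split_beta if_distrib if_distribR cong: if_cong)
    qed
    show "\<forall>t\<in>{0..0 + 1}. (y has_vector_derivative (\<Sum>\<sigma>\<in>P. f \<sigma> t (y t))) (at t within {0..0 + 1})"
    proof
      fix t :: real
      have "(y has_vector_derivative t ^ m *\<^sub>R e) (at t within {0..0 + 1})"
        unfolding y_def
        by (auto intro!: derivative_eq_intros simp del: power_Suc of_nat_Suc)
      then show "(y has_vector_derivative (\<Sum>\<sigma>\<in>P. f \<sigma> t (y t))) (at t within {0..0 + 1})"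
        unfolding f_def using P by simp
    qed
    show "\<forall>\<^sub>F H in at_right 0. gark_step P S A b d f 0 0 H (Y H) (y1 H)"
      unfolding gark_step_def f_sum by (simp add: Y_def y1_def mult_ac)
    show "\<forall>i\<in>S. ((\<lambda>H. Y H i) \<longlongrightarrow> 0) (at_right 0)"
      unfolding Y_def by (auto intro!: tendsto_eq_intros)
  qed (auto simp: y_def)
  then have "O_pow 4 (\<lambda>H. y1 H - y H)" by (simp add: O_pow_iff_bigo)
  then have "O_pow (Suc (Suc m)) (\<lambda>H. y1 H - y H)" by (rule O_pow_mono) (use m in simp)
  then have "O_pow (Suc (Suc m)) (\<lambda>H. H ^ Suc m *\<^sub>R ((\<Sum>j\<in>S. b \<sigma> j * d j ^ m) - 1 / real (Suc m)) *\<^sub>R e)"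
    by (rule O_pow_cong) (simp add: y1_def y_def algebra_simps)
  then show ?thesis using O_pow_power_imp_zero e by fastforce
qed

text \<open>
  The stage equations of the linear test problem below have the form \<open>X = a + H M X\<close>,
  which for small \<open>H\<close> is solved by the Neumann series \<open>\<Sum>n. H^n M^n a\<close>.
\<close>

lemma linear_stages:
  fixes M :: "'i \<Rightarrow> 'i \<Rightarrow> real"
  assumes "finite S"
  obtains X C where "\<forall>\<^sub>F H in at_right 0. \<forall>i\<in>S. X H i = a i + H * (\<Sum>j\<in>S. M i j * X H j)"
    "\<forall>\<^sub>F H in at_right 0. \<forall>i\<in>S. \<bar>X H i\<bar> \<le> C"
proof -
  \<comment> \<open>The sum of all absolute entries dominates every row sum, so \<open>K^n R\<close>
    bounds the n-th iterate at every stage.\<close>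
  define K where "K = (\<Sum>i\<in>S. \<Sum>j\<in>S. \<bar>M i j\<bar>)"
  define R where "R = (\<Sum>i\<in>S. \<bar>a i\<bar>)"
  define v where "v n = ((\<lambda>x i. \<Sum>j\<in>S. M i j * x j) ^^ n) a" for n
  define X where "X H i = (\<Sum>n. H ^ n * v n i)" for H i
  have v0: "v 0 i = a i" and vS: "v (Suc n) i = (\<Sum>j\<in>S. M i j * v n j)" for n i
    by (simp_all add: v_def)
  have K0: "K \<ge> 0" and R0: "R \<ge> 0" by (auto simp: K_def R_def sum_nonneg)
  have v_bound: "i \<in> S \<Longrightarrow> \<bar>v n i\<bar> \<le> K ^ n * R" for n i
  proof (induction n arbitrary: i)
    case 0
    then show ?case using assms by (auto simp: v0 R_def intro: member_le_sum)
  next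
    case (Suc n)
    have "\<bar>v (Suc n) i\<bar> \<le> (\<Sum>j\<in>S. \<bar>M i j\<bar> * (K ^ n * R))"
      unfolding vS by (intro order_trans[OF sum_abs] sum_mono) (auto simp: abs_mult intro!: mult_left_mono Suc.IH)
    also have "\<dots> = (\<Sum>j\<in>S. \<bar>M i j\<bar>) * (K ^ n * R)" by (simp add: sum_distrib_right)
    also have "\<dots> \<le> K * (K ^ n * R)"
      unfolding K_def using K0 R0 Suc.prems assms
      by (intro mult_right_mono member_le_sum[where f = "\<lambda>i. \<Sum>j\<in>S. \<bar>M i j\<bar>"])
        (auto intro!: sum_nonneg mult_nonneg_nonneg simp: K_def[symmetric])
    finally show ?case by (simp add: mult_ac)
  qed
  have "((\<lambda>H. H * K) \<longlongrightarrow> 0) (at_right 0)" by (auto intro!: tendsto_eq_intros)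
  \<comment> \<open>Below 1/2 the geometric series is at most 2. This is the origin of the bound
    \<open>2 * R\<close>, which is uniform in \<open>H\<close>.\<close>
  then have ev: "\<forall>\<^sub>F H in at_right 0. H * K < 1 / 2" by (rule order_tendstoD) simp
  have term_bound: "norm (H ^ n * v n i) \<le> R * (H * K) ^ n" if "i \<in> S" "0 < H" for H i n
  proof -
    have "H ^ n * \<bar>v n i\<bar> \<le> H ^ n * (K ^ n * R)" using that by (intro mult_left_mono v_bound) auto
    then show ?thesis using that by (simp add: abs_mult power_mult_distrib mult_ac)
  qed
  have geom: "summable (\<lambda>n. R * (H * K) ^ n)" if "0 < H" "H * K < 1 / 2" for H
    using that K0 by (intro summable_mult summable_geometric) auto
  have summ: "summable (\<lambda>n. H ^ n * v n i)" if "i \<in> S" "0 < H" "H * K < 1 / 2" for H i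
    by (rule summable_comparison_test'[OF geom[OF that(2,3)] term_bound[OF that(1,2)]])
  show ?thesis
  proof (rule that[of X "2 * R"])
    show "\<forall>\<^sub>F H in at_right 0. \<forall>i\<in>S. X H i = a i + H * (\<Sum>j\<in>S. M i j * X H j)"
      using ev eventually_at_right_less[of "0::real"]
    proof eventually_elim
      case (elim H)
      show ?case
      proof
        fix i assume i: "i \<in> S"
        have "X H i = H ^ 0 * v 0 i + (\<Sum>n. H ^ Suc n * v (Suc n) i)"
          unfolding X_def using suminf_split_head[OF summ[OF i]] elim by simp
        also have "(\<lambda>n. H ^ Suc n * v (Suc n) i) = (\<lambda>n. \<Sum>j\<in>S. H * M i j * (H ^ n * v n j))"
          by (simp add: vS sum_distrib_left mult_ac)
        also have "(\<Sum>n. \<Sum>j\<in>S. H * M i j * (H ^ n * v n j)) = (\<Sum>j\<in>S. \<Sum>n. H * M i j * (H ^ n * v n j))"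
          using elim by (intro suminf_sum summable_mult summ) auto
        also have "\<dots> = (\<Sum>j\<in>S. H * M i j * X H j)"
          unfolding X_def using elim by (intro sum.cong refl suminf_mult summ) auto
        finally show "X H i = a i + H * (\<Sum>j\<in>S. M i j * X H j)"
          by (simp add: v0 sum_distrib_left mult_ac)
      qed
    qed
    show "\<forall>\<^sub>F H in at_right 0. \<forall>i\<in>S. \<bar>X H i\<bar> \<le> 2 * R"
      using ev eventually_at_right_less[of "0::real"]
    proof eventually_elim
      case (elim H)
      show ?case
      proof
        fix i assume i: "i \<in> S"
        have "\<bar>X H i\<bar> \<le> (\<Sum>n. R * (H * K) ^ n)"
          unfolding X_def using elim norm_suminf_le[OF term_bound[OF i] geom] by simp
        also have "\<dots> = R * (1 / (1 - H * K))"
          using elim K0 by (subst suminf_mult) (auto simp: suminf_geometric intro!: summable_geometric)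
        also have "\<dots> \<le> R * 2" using elim R0 by (intro mult_left_mono) (auto simp: field_simps)
        finally show "\<bar>X H i\<bar> \<le> 2 * R" by simp
      qed
    qed
  qed
qed

lemma O_pow_exp_remainder: "O_pow 4 (\<lambda>h::real. exp h - 1 - h - h\<^sup>2 / 2 - h ^ 3 / 6)"
proof (rule O_powI)
  have "\<forall>\<^sub>F h in at_right 0. h \<in> {0<..<1::real}" by (rule eventually_at_right_real) simp
  then show "\<forall>\<^sub>F h::real in at_right 0. norm (exp h - 1 - h - h\<^sup>2 / 2 - h ^ 3 / 6) \<le> exp 1 / 24 * h ^ 4"
  proof eventually_elim
    case (elim h)
    obtain t where t: "\<bar>t\<bar> \<le> \<bar>h\<bar>" "exp h = (\<Sum>m<4. h ^ m / fact m) + exp t / fact 4 * h ^ 4"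
      using Maclaurin_exp_le[of h 4] by blast
    have "(\<Sum>m<4. h ^ m / fact m) = 1 + h + h\<^sup>2 / 2 + h ^ 3 / 6"
      by (simp add: eval_nat_numeral fact_numeral)
    moreover have "exp t \<le> exp 1" using t(1) elim by auto
    ultimately show ?case using t(2) by (simp add: fact_numeral abs_mult divide_right_mono mult_right_mono)
  qed
qed

text \<open>
  The state space may have dimension one, so no test problem that makes the stage equations explicit is
  available. For \<open>y' = y + t e\<close>, with \<open>y\<close> contributed by \<open>\<sigma>\<close> and \<open>t e\<close> by \<open>\<tau>\<close>, they are at least linear.
\<close>

lemma gark_order_imp_coupling:
  fixes P :: "component set"
  assumes ord: "has_order P S (gark_step P S A b d) 3 TYPE('a::euclidean_space)"
    and P: "finite P" "\<sigma> \<in> P" "\<tau> \<in> P" and S: "finite S"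
  shows "(\<Sum>i\<in>S. b \<sigma> i * (\<Sum>j\<in>S. A \<tau> i j * d j)) = 1/6"
proof -
  obtain e :: 'a where e: "e \<noteq> 0" using SOME_Basis nonzero_Basis by blast
  define a where "a i = (\<Sum>j\<in>S. A \<tau> i j * d j)" for i
  obtain X C where X: "\<forall>\<^sub>F H in at_right 0. \<forall>i\<in>S. X H i = a i + H * (\<Sum>j\<in>S. A \<sigma> i j * X H j)"
    and C: "\<forall>\<^sub>F H in at_right 0. \<forall>i\<in>S. \<bar>X H i\<bar> \<le> C"
    using linear_stages[OF S] by blast
  have X0: "O_pow 0 (\<lambda>H. X H i)" if "i \<in> S" for i
    by (rule O_powI[of _ C]) (use C that in \<open>auto elim: eventually_mono\<close>)
  have b\<tau>: "(\<Sum>j\<in>S. b \<tau> j * d j) = 1/2"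
    using gark_order_imp_quadrature[OF ord P(1,3), of 1] by simp
  \<comment> \<open>A sum of two conditionals, so that \<open>\<sigma> = \<tau>\<close> is covered
    by the same formula.\<close>
  define f where "f \<rho> t x = (if \<rho> = \<sigma> then x else 0) + (if \<rho> = \<tau> then t *\<^sub>R e else 0)" for \<rho> t and x :: 'a
  define y where "y t = (exp t - 1 - t) *\<^sub>R e" for t :: real
  \<comment> \<open>The forcing \<open>t e\<close> enters stage \<open>i\<close> as
    \<open>H^2 a i\<close>; dividing the stage equations by \<open>H^2\<close> leaves the linear
    system solved by \<open>X\<close>.\<close>
  define Y where "Y H i = (H\<^sup>2 * X H i) *\<^sub>R e" for H i
  \<comment> \<open>The 1/2 is \<open>b \<tau>\<close> applied to \<open>d\<close>, known from the
    quadrature conditions.\<close>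
  define y1 where "y1 H = (H\<^sup>2 * (1/2 + H * (\<Sum>j\<in>S. b \<sigma> j * X H j))) *\<^sub>R e" for H
  have f_sum: "(\<Sum>\<rho>\<in>P. \<Sum>j\<in>S. r \<rho> j *\<^sub>R f \<rho> (0 + d j * H) (Y H j)) =
      (H\<^sup>2 * (\<Sum>j\<in>S. r \<sigma> j * X H j) + H * (\<Sum>j\<in>S. r \<tau> j * d j)) *\<^sub>R e"
    for r :: "component \<Rightarrow> _ \<Rightarrow> real" and H
    unfolding f_def scaleR_add_right sum.distrib sum_only[OF P(1,2)] sum_only[OF P(1,3)] Y_def
    by (simp add: sum_distrib_left scaleR_sum_left scaleR_add_left mult_ac)
  obtain k where k: "\<And>(f :: component \<Rightarrow> real \<Rightarrow> 'a \<Rightarrow> 'a) t0 y0 \<delta> y Y y1.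
       (\<forall>\<sigma>\<in>P. C_k k (\<lambda>(t, x). f \<sigma> t x)) \<Longrightarrow> \<delta> > 0 \<Longrightarrow> y t0 = y0 \<Longrightarrow>
       (\<forall>t\<in>{t0..t0+\<delta>}.
          (y has_vector_derivative (\<Sum>\<sigma>\<in>P. f \<sigma> t (y t))) (at t within {t0..t0+\<delta>})) \<Longrightarrow>
       (\<forall>\<^sub>F H in at_right 0. gark_step P S A b d f t0 y0 H (Y H) (y1 H)) \<Longrightarrow>
       (\<forall>i\<in>S. ((\<lambda>H. Y H i) \<longlongrightarrow> y0) (at_right 0)) \<Longrightarrow>
       (\<lambda>H. norm (y1 H - y (t0 + H))) \<in> O[at_right 0](\<lambda>H. H ^ (3 + 1))"
    using ord unfolding has_order_def by blast
  have "(\<lambda>H. norm (y1 H - y (0 + H))) \<in> O[at_right 0](\<lambda>H. H ^ (3 + 1))"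
  proof (rule k[of f 1 y 0 0 Y y1])
    show "\<forall>\<sigma>\<in>P. C_k k (\<lambda>(t, x). f \<sigma> t x)"
    proof
      fix \<rho>
      have "bounded_linear (\<lambda>p :: real \<times> 'a. (if \<rho> = \<sigma> then snd p else 0) + (if \<rho> = \<tau> then fst p *\<^sub>R e else 0))"
        by (intro bounded_linear_add)
          (cases "\<rho> = \<sigma>"; cases "\<rho> = \<tau>"; simp add: bounded_linear_intros)+
      then show "C_k k (\<lambda>(t, x). f \<rho> t x)"
        unfolding f_def split_beta by (rule C_k_bounded_linear)
    qed
    show "\<forall>t\<in>{0..0 + 1}. (y has_vector_derivative (\<Sum>\<sigma>\<in>P. f \<sigma> t (y t))) (at t within {0..0 + 1})"
    proof
      fix t :: real
      have "(y has_vector_derivative y t + t *\<^sub>R e) (at t within {0..0 + 1})"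
        unfolding y_def
        by (auto intro!: derivative_eq_intros simp: algebra_simps)
      then show "(y has_vector_derivative (\<Sum>\<sigma>\<in>P. f \<sigma> t (y t))) (at t within {0..0 + 1})"
        unfolding f_def sum.distrib using P by simp
    qed
    show "\<forall>\<^sub>F H in at_right 0. gark_step P S A b d f 0 0 H (Y H) (y1 H)"
      using X
    proof eventually_elim
      case (elim H)
      have "Y H i = 0 + H *\<^sub>R (H\<^sup>2 * (\<Sum>j\<in>S. A \<sigma> i j * X H j) + H * (\<Sum>j\<in>S. A \<tau> i j * d j)) *\<^sub>R e"
        if "i \<in> S" for i
        unfolding Y_def elim[rule_format, OF that] a_def by (simp add: power2_eq_square algebra_simps)
      then show ?case
        unfolding gark_step_def f_sum b\<tau> by (auto simp: y1_def power2_eq_square algebra_simps)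
    qed
    show "\<forall>i\<in>S. ((\<lambda>H. Y H i) \<longlongrightarrow> 0) (at_right 0)"
    proof
      fix i assume i: "i \<in> S"
      from O_pow_Suc_scaleR[OF X0[OF i]] have "((\<lambda>H. H * X H i) \<longlongrightarrow> 0) (at_right 0)"
        using O_pow_imp_tendsto by fastforce
      then have "((\<lambda>H. (H * (H * X H i)) *\<^sub>R e) \<longlongrightarrow> (0 * 0) *\<^sub>R e) (at_right 0)"
        by (rule tendsto_scaleR[OF tendsto_mult[OF tendsto_ident_at] tendsto_const])
      then show "((\<lambda>H. Y H i) \<longlongrightarrow> 0) (at_right 0)"
        by (simp add: Y_def power2_eq_square mult_ac)
    qed
  qed (auto simp: y_def)
  then have s1: "O_pow 4 (\<lambda>H. y1 H - y H)" by (simp add: O_pow_iff_bigo)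
  define \<gamma> where "\<gamma> = (\<Sum>i\<in>S. b \<sigma> i * a i)"
  define r where "r H = (\<Sum>i\<in>S. b \<sigma> i * (\<Sum>j\<in>S. A \<sigma> i j * X H j))" for H
  have "O_pow 0 (\<lambda>H. \<Sum>i\<in>S. b \<sigma> i *\<^sub>R (\<Sum>j\<in>S. A \<sigma> i j *\<^sub>R X H j))"
    by (intro O_pow_sum O_pow_scaleR X0)
  then have "O_pow 0 r" by (rule O_pow_cong) (simp add: r_def)
  then have s2: "O_pow 4 (\<lambda>H. H ^ 4 *\<^sub>R r H)"
    using O_pow_Suc_scaleR[OF O_pow_Suc_scaleR[OF O_pow_Suc_scaleR[OF O_pow_Suc_scaleR]], of 0 r]
    by (simp add: eval_nat_numeral mult_ac)
  \<comment> \<open>Inserting the stage equations once into \<open>y1\<close> isolates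
    \<open>H^4 r\<close>. Removing this term and the tail of the exponential leaves exactly
    \<open>H^3 (\<gamma> - 1/6) e\<close>.\<close>
  have s3: "O_pow 4 (\<lambda>H. (y1 H - y H) - (H ^ 4 *\<^sub>R r H) *\<^sub>R e + (exp H - 1 - H - H\<^sup>2 / 2 - H ^ 3 / 6) *\<^sub>R e)"
    by (intro O_pow_add O_pow_diff s1 O_pow_bounded_linear[OF bounded_linear_scaleR_left] s2 O_pow_exp_remainder)
  have "O_pow (Suc 3) (\<lambda>H. H ^ 3 *\<^sub>R (\<gamma> - 1/6) *\<^sub>R e)"
  proof (rule O_pow_cong_ev)
    show "O_pow (Suc 3) (\<lambda>H. (y1 H - y H) - (H ^ 4 *\<^sub>R r H) *\<^sub>R e + (exp H - 1 - H - H\<^sup>2 / 2 - H ^ 3 / 6) *\<^sub>R e)"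
      using s3 by simp
    show "\<forall>\<^sub>F H in at_right 0. H ^ 3 *\<^sub>R (\<gamma> - 1/6) *\<^sub>R e =
      (y1 H - y H) - (H ^ 4 *\<^sub>R r H) *\<^sub>R e + (exp H - 1 - H - H\<^sup>2 / 2 - H ^ 3 / 6) *\<^sub>R e"
      using X
    proof eventually_elim
      case (elim H)
      have "(\<Sum>j\<in>S. b \<sigma> j * X H j) = (\<Sum>j\<in>S. b \<sigma> j * (a j + H * (\<Sum>l\<in>S. A \<sigma> j l * X H l)))"
        using elim by (intro sum.cong) auto
      also have "\<dots> = \<gamma> + H * r H"
        by (simp add: \<gamma>_def r_def sum.distrib sum_distrib_left algebra_simps)
      finally show ?case
        by (simp add: y1_def y_def scaleR_left_diff_distrib[symmetric] scaleR_left_distrib[symmetric])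
          (simp add: eval_nat_numeral algebra_simps)
    qed
  qed
  then have "\<gamma> = 1/6" using O_pow_power_imp_zero e by fastforce
  then show ?thesis by (simp add: \<gamma>_def a_def)
qed

theorem gark_order_3_iff:
  fixes P :: "component set"
  assumes "finite P" "finite S"
    and "\<And>\<sigma> i. \<sigma> \<in> P \<Longrightarrow> i \<in> S \<Longrightarrow> (\<Sum>j\<in>S. A \<sigma> i j) = d i"
  shows "has_order P S (gark_step P S A b d) 3 TYPE('a::euclidean_space) \<longleftrightarrow>
    gark_order_conditions P S A b d"
proof
  assume ord: "has_order P S (gark_step P S A b d) 3 TYPE('a)"
  have "(\<Sum>j\<in>S. b \<sigma> j) = 1 \<and> (\<Sum>j\<in>S. b \<sigma> j * d j) = 1/2 \<and> (\<Sum>j\<in>S. b \<sigma> j * (d j)\<^sup>2) = 1/3"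
    if "\<sigma> \<in> P" for \<sigma>
    using gark_order_imp_quadrature[OF ord assms(1) that, of 0]
      gark_order_imp_quadrature[OF ord assms(1) that, of 1]
      gark_order_imp_quadrature[OF ord assms(1) that, of 2] by simp
  then show "gark_order_conditions P S A b d"
    unfolding gark_order_conditions_def
    using gark_order_imp_coupling[OF ord assms(1) _ _ assms(2)] by blast
next
  assume "gark_order_conditions P S A b d"
  with assms(3) show "has_order P S (gark_step P S A b d) 3 TYPE('a)"
    by (rule gark_conditions_imp_order)
qed

section \<open>The fast method and the base method as additive schemes\<close>

lemma finite_component_set: "finite (P :: component set)"
  by (rule finite_subset[of _ "{Impl, Expl, Fast}"]) (use component.exhaust in auto)

lemma rk_order_3_iff:
  assumes "\<And>p. p \<in> {1..s} \<Longrightarrow> mat_vec s A (\<lambda>_. 1) p = c p"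
  shows "rk_order s A b c 3 TYPE('a::euclidean_space) \<longleftrightarrow>
    gark_order_conditions {Fast} {1..s} (\<lambda>_. A) (\<lambda>_. b) c"
proof -
  have "rk_step s A b c = (gark_step {Fast} {1..s} (\<lambda>_. A) (\<lambda>_. b) c ::
      (component \<Rightarrow> real \<Rightarrow> 'a \<Rightarrow> 'a) \<Rightarrow> _)"
    by (intro ext) (simp add: rk_step_def gark_step_def)
  then show ?thesis
    unfolding rk_order_def
    using gark_order_3_iff[of "{Fast}" "{1..s}" "\<lambda>_. A" c "\<lambda>_. b", where 'a = 'a] assms
    by (simp add: mat_vec_def)
qed

text \<open>Stiff accuracy: the weights are row \<open>s\<close> of the matrices, so the update
  formula of \<open>gark_step\<close> repeats the last stage equation.\<close>

lemma imex_ark_order_3_iff: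
  assumes "s \<ge> 1" "\<And>i. i \<in> {1..s} \<Longrightarrow> mat_vec s (A Impl) (\<lambda>_. 1) i = c i"
    "\<And>i. i \<in> {1..s} \<Longrightarrow> mat_vec s (A Expl) (\<lambda>_. 1) i = c i"
  shows "imex_ark_order s (A Impl) (A Expl) c 3 TYPE('a::euclidean_space) \<longleftrightarrow>
    gark_order_conditions {Impl, Expl} {1..s} A (\<lambda>\<sigma>. A \<sigma> s) c"
proof -
  have "imex_ark_step s (A Impl) (A Expl) c f t0 y0 H Y y1 =
      gark_step {Impl, Expl} {1..s} A (\<lambda>\<sigma>. A \<sigma> s) c f t0 y0 H Y y1"
    for f :: "component \<Rightarrow> real \<Rightarrow> 'a \<Rightarrow> 'a" and t0 y0 H Y y1
  proof -
    define R where "R i = y0 + H *\<^sub>R (\<Sum>\<sigma>\<in>{Impl, Expl}. \<Sum>j=1..s. A \<sigma> i j *\<^sub>R f \<sigma> (t0 + c j * H) (Y j))" for i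
    have "imex_ark_step s (A Impl) (A Expl) c f t0 y0 H Y y1 \<longleftrightarrow> (\<forall>i\<in>{1..s}. Y i = R i) \<and> y1 = Y s"
      by (simp add: imex_ark_step_def R_def scaleR_add_right add.assoc)
    also have "\<dots> \<longleftrightarrow> (\<forall>i\<in>{1..s}. Y i = R i) \<and> y1 = R s"
      using assms(1) by (metis atLeastAtMost_iff order_refl)
    finally show ?thesis unfolding gark_step_def R_def .
  qed
  then have "imex_ark_step s (A Impl) (A Expl) c = (gark_step {Impl, Expl} {1..s} A (\<lambda>\<sigma>. A \<sigma> s) c ::
      (component \<Rightarrow> real \<Rightarrow> 'a \<Rightarrow> 'a) \<Rightarrow> _)"
    by (intro ext)
  then show ?thesis
    unfolding imex_ark_order_def
    using gark_order_3_iff[of "{Impl, Expl}" "{1..s}" A c "\<lambda>\<sigma>. A \<sigma> s", where 'a = 'a] assms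
    by (auto simp: mat_vec_def)
qed

section \<open>The IMEX-MRI-GARK scheme\<close>

lemma finite_mri_stages: "finite (mri_stages s sF)"
proof -
  have "{FastStage i p | i p. i \<in> {2..s} \<and> p \<in> {1..sF}} = (\<lambda>(i, p). FastStage i p) ` ({2..s} \<times> {1..sF})"
    by auto
  then show ?thesis by (simp add: mri_stages_def)
qed

lemma sum_mri_stages:
  "(\<Sum>x\<in>mri_stages s sF. \<phi> x) = (\<Sum>j=1..s. \<phi> (Slow j)) + (\<Sum>i=2..s. \<Sum>p=1..sF. \<phi> (FastStage i p))"
proof -
  have F: "{FastStage i p | i p. i \<in> {2..s} \<and> p \<in> {1..sF}} = (\<lambda>(i, p). FastStage i p) ` ({2..s} \<times> {1..sF})"
    by auto
  have "(\<Sum>x\<in>mri_stages s sF. \<phi> x) =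
      (\<Sum>x\<in>Slow ` {1..s}. \<phi> x) + (\<Sum>x\<in>(\<lambda>(i, p). FastStage i p) ` ({2..s} \<times> {1..sF}). \<phi> x)"
    unfolding mri_stages_def F by (rule sum.union_disjoint) auto
  also have "\<dots> = (\<Sum>j=1..s. \<phi> (Slow j)) + (\<Sum>(i, p)\<in>{2..s} \<times> {1..sF}. \<phi> (FastStage i p))"
    by (subst (1 2) sum.reindex) (auto simp: inj_on_def split_beta)
  finally show ?thesis by (simp add: sum.cartesian_product)
qed

text \<open>\<open>G\<close> packs \<open>\<Gamma>\<close> and \<open>\<Omega>\<close> into one
  family, so that both slow components share every computation. The fast coefficients are built from
  \<open>\<Delta>c\<close>, \<open>AF\<close> and \<open>bF\<close> in \<open>incr\<close>.\<close>

locale mri_gark =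
  fixes s kmax sF :: nat
    and c \<Delta>c :: "nat \<Rightarrow> real"
    and G :: "component \<Rightarrow> nat \<Rightarrow> nat \<Rightarrow> nat \<Rightarrow> real"
    and AF :: "nat \<Rightarrow> nat \<Rightarrow> real"
    and bF cF :: "nat \<Rightarrow> real"
  assumes s: "s \<ge> 1"
    and c_1: "c 1 = 0"
    and dc_1: "\<Delta>c 1 = 0"
    and dc: "\<And>i. i \<in> {2..s} \<Longrightarrow> \<Delta>c i = c i - c (i - 1)"
    and G_upper: "\<And>\<sigma> k i j. k \<le> kmax \<Longrightarrow> i \<in> {1..s} \<Longrightarrow> j \<in> {1..s} \<Longrightarrow> i < j \<Longrightarrow> G \<sigma> k i j = 0"
    and G_Expl_diag: "\<And>k i. k \<le> kmax \<Longrightarrow> i \<in> {1..s} \<Longrightarrow> G Expl k i i = 0"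
    and G_1: "\<And>\<sigma> k j. k \<le> kmax \<Longrightarrow> j \<in> {1..s} \<Longrightarrow> G \<sigma> k 1 j = 0"
    and G_0_sum: "\<And>\<sigma> i. i \<in> {1..s} \<Longrightarrow> mat_vec s (G \<sigma> 0) (\<lambda>_. 1) i = \<Delta>c i"
    and G_sum: "\<And>\<sigma> k i. k \<in> {1..kmax} \<Longrightarrow> i \<in> {1..s} \<Longrightarrow> mat_vec s (G \<sigma> k) (\<lambda>_. 1) i = 0"
    and base_sum: "\<And>\<sigma> i. i \<in> {1..s} \<Longrightarrow> mat_vec s (base_mat s kmax (G \<sigma>)) (\<lambda>_. 1) i = c i"
    and AF_sum: "\<And>p. p \<in> {1..sF} \<Longrightarrow> mat_vec sF AF (\<lambda>_. 1) p = cF p"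
    and bF_quad: "\<And>k. k \<le> kmax \<Longrightarrow> dot sF bF (\<lambda>l. cF l ^ k) = 1 / (real k + 1)"
begin

abbreviation S :: "mri_stage set" where "S \<equiv> mri_stages s sF"

abbreviation base :: "component \<Rightarrow> nat \<Rightarrow> nat \<Rightarrow> real" where "base \<sigma> \<equiv> base_mat s kmax (G \<sigma>)"

text \<open>
  With $w$ the weights $b^F$ or a row of $A^{F,F}$, this is the coefficient vector (over all stages)
  of what the $i$-th fast problem adds to the slow stage \<open>i - 1\<close>. The coefficients of a stage are thus
  sums of such increments.
\<close>

definition incr :: "component \<Rightarrow> nat \<Rightarrow> (nat \<Rightarrow> real) \<Rightarrow> mri_stage \<Rightarrow> real" where
  "incr \<sigma> i w x = (case x of
     Slow j \<Rightarrow> if \<sigma> = Fast then 0 else (\<Sum>l=1..sF. w l * coeff_poly kmax (G \<sigma>) i j (cF l))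
   | FastStage k l \<Rightarrow> if \<sigma> = Fast \<and> k = i then \<Delta>c i * w l else 0)"

text \<open>The recursion from slow stage to slow stage is unrolled down to \<open>y0\<close>. The
  sums start at 2 because the first slow stage is \<open>y0\<close> itself; for
  \<open>Slow 1\<close> and \<open>FastStage 2 p\<close> they are empty.\<close>

primrec stage_mat :: "component \<Rightarrow> mri_stage \<Rightarrow> mri_stage \<Rightarrow> real" where
  "stage_mat \<sigma> (Slow i) = (\<lambda>x. \<Sum>k=2..i. incr \<sigma> k bF x)"
| "stage_mat \<sigma> (FastStage i p) = (\<lambda>x. (\<Sum>k=2..i-1. incr \<sigma> k bF x) + incr \<sigma> i (AF p) x)"

primrec node :: "mri_stage \<Rightarrow> real" where
  "node (Slow i) = c i"
| "node (FastStage i p) = c (i - 1) + cF p * \<Delta>c i"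

text \<open>\<open>\<phi>\<close> takes values in any real vector space: with right-hand sides for
  \<open>\<phi>\<close> the scheme is rewritten, with real \<open>\<phi>\<close> the order
  conditions are evaluated.\<close>

lemma sum_incr_slow:
  assumes "\<sigma> \<noteq> Fast"
  shows "(\<Sum>x\<in>S. incr \<sigma> i w x *\<^sub>R \<phi> x) =
    (\<Sum>l=1..sF. w l *\<^sub>R (\<Sum>j=1..s. coeff_poly kmax (G \<sigma>) i j (cF l) *\<^sub>R (\<phi> (Slow j) :: 'b::real_vector)))"
proof -
  have "(\<Sum>x\<in>S. incr \<sigma> i w x *\<^sub>R \<phi> x) =
      (\<Sum>j=1..s. (\<Sum>l=1..sF. w l * coeff_poly kmax (G \<sigma>) i j (cF l)) *\<^sub>R \<phi> (Slow j))"
    using assms by (simp add: sum_mri_stages incr_def)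
  also have "\<dots> = (\<Sum>l=1..sF. w l *\<^sub>R (\<Sum>j=1..s. coeff_poly kmax (G \<sigma>) i j (cF l) *\<^sub>R \<phi> (Slow j)))"
    unfolding scaleR_sum_left scaleR_sum_right by (subst sum.swap) simp
  finally show ?thesis .
qed

lemma sum_incr_fast:
  assumes "i \<in> {2..s}"
  shows "(\<Sum>x\<in>S. incr Fast i w x *\<^sub>R \<phi> x) = (\<Sum>l=1..sF. w l *\<^sub>R \<Delta>c i *\<^sub>R (\<phi> (FastStage i l) :: 'b::real_vector))"
proof -
  have "(\<Sum>p=1..sF. incr Fast i w (FastStage k p) *\<^sub>R \<phi> (FastStage k p)) =
      (if k = i then (\<Sum>l=1..sF. w l *\<^sub>R \<Delta>c i *\<^sub>R \<phi> (FastStage i l)) else 0)" for k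
    by (simp add: incr_def mult.commute)
  moreover have "incr Fast i w (Slow j) = 0" for j
    by (simp add: incr_def)
  ultimately show ?thesis using assms by (simp add: sum_mri_stages del: One_nat_def)
qed

lemma sum_stage_mat_Slow:
  "(\<Sum>x\<in>S. stage_mat \<sigma> (Slow i) x *\<^sub>R \<phi> x) = (\<Sum>k=2..i. \<Sum>x\<in>S. incr \<sigma> k bF x *\<^sub>R (\<phi> x :: 'b::real_vector))"
  unfolding stage_mat.simps scaleR_sum_left by (rule sum.swap)

lemma sum_stage_mat_FastStage:
  "(\<Sum>x\<in>S. stage_mat \<sigma> (FastStage i p) x *\<^sub>R \<phi> x) =
    (\<Sum>x\<in>S. stage_mat \<sigma> (Slow (i - 1)) x *\<^sub>R \<phi> x) + (\<Sum>x\<in>S. incr \<sigma> i (AF p) x *\<^sub>R (\<phi> x :: 'b::real_vector))"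
  by (simp add: scaleR_add_left sum.distrib)

text \<open>Triangularity lets both slow sums run over all slow stages, since the added coefficients
  vanish; every component then has the same form.\<close>

lemma mri_fast_rhs_eq:
  assumes i: "i \<in> {2..s}"
  shows "(\<Sum>l=1..sF. w l *\<^sub>R mri_fast_rhs c \<Delta>c kmax (G Impl) (G Expl) cF f t0 H Y i l) =
    (\<Sum>\<sigma>\<in>{Impl, Expl, Fast}. \<Sum>x\<in>S. incr \<sigma> i w x *\<^sub>R (f \<sigma> (t0 + node x * H) (Y x) :: 'b::real_vector))"
proof -
  have coeff_upper: "coeff_poly kmax (G \<sigma>) i j \<tau> = 0" if "j \<in> {1..s}" "i < j" for \<sigma> j \<tau>
    unfolding coeff_poly_def using that i by (intro sum.neutral) (auto simp: G_upper)
  have coeff_diag: "coeff_poly kmax (G Expl) i i \<tau> = 0" for \<tau>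
    unfolding coeff_poly_def using i by (intro sum.neutral) (auto simp: G_Expl_diag)
  have I: "(\<Sum>j=1..i. coeff_poly kmax (G Impl) i j \<tau> *\<^sub>R \<phi> j) =
      (\<Sum>j=1..s. coeff_poly kmax (G Impl) i j \<tau> *\<^sub>R (\<phi> j :: 'b))" for \<phi> \<tau>
    by (rule sum.mono_neutral_left) (use i in \<open>auto simp: coeff_upper\<close>)
  have E: "(\<Sum>j=1..<i. coeff_poly kmax (G Expl) i j \<tau> *\<^sub>R \<phi> j) =
      (\<Sum>j=1..s. coeff_poly kmax (G Expl) i j \<tau> *\<^sub>R (\<phi> j :: 'b))" for \<phi> \<tau>
  proof (rule sum.mono_neutral_left)
    show "\<forall>j\<in>{1..s} - {1..<i}. coeff_poly kmax (G Expl) i j \<tau> *\<^sub>R \<phi> j = 0"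
    proof
      fix j assume "j \<in> {1..s} - {1..<i}"
      then have "j \<in> {1..s}" "j = i \<or> i < j" by auto
      then show "coeff_poly kmax (G Expl) i j \<tau> *\<^sub>R \<phi> j = 0" by (auto simp: coeff_upper coeff_diag)
    qed
  qed (use i in auto)
  show ?thesis
    unfolding mri_fast_rhs_def I E
    by (simp add: sum_incr_slow sum_incr_fast[OF i] scaleR_add_right sum.distrib algebra_simps)
qed

text \<open>The scheme advances from one slow stage to the next, whereas \<open>gark_step\<close>
  refers every stage to \<open>y0\<close>. Induction over the slow stages leads from the first form
  to the second; comparing neighbouring stages leads back.\<close>

lemma imex_mri_gark_step_eq:
  fixes f :: "component \<Rightarrow> real \<Rightarrow> 'b \<Rightarrow> 'b::real_vector"
  shows "imex_mri_gark_step s c \<Delta>c kmax (G Impl) (G Expl) sF AF bF cF f t0 y0 H Y y1 \<longleftrightarrow>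
    gark_step {Impl, Expl, Fast} S stage_mat (\<lambda>\<sigma>. stage_mat \<sigma> (Slow s)) node f t0 y0 H Y y1"
    (is "?mri \<longleftrightarrow> ?gark")
proof -
  define I where "I i w = (\<Sum>\<sigma>\<in>{Impl, Expl, Fast}. \<Sum>x\<in>S. incr \<sigma> i w x *\<^sub>R f \<sigma> (t0 + node x * H) (Y x))" for i w
  define T where "T z = (\<Sum>\<sigma>\<in>{Impl, Expl, Fast}. \<Sum>x\<in>S. stage_mat \<sigma> z x *\<^sub>R f \<sigma> (t0 + node x * H) (Y x))" for z
  have T_slow: "T (Slow i) = (\<Sum>k=2..i. I k bF)" for i
    by (simp add: T_def I_def sum_stage_mat_Slow sum.distrib del: stage_mat.simps)
  have T_fast: "T (FastStage i p) = T (Slow (i - 1)) + I i (AF p)" for i p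
    by (simp add: T_def I_def sum_stage_mat_FastStage algebra_simps del: stage_mat.simps)
  have T_1: "T (Slow 1) = 0" by (simp add: T_slow)
  have T_step: "T (Slow i) = T (Slow (i - 1)) + I i bF" if i: "i \<in> {2..s}" for i
  proof -
    obtain n where n: "i = Suc n" "2 \<le> Suc n" using i by (cases i) auto
    then show ?thesis by (simp add: T_slow)
  qed
  have mri: "?mri \<longleftrightarrow> Y (Slow 1) = y0 \<and> (\<forall>i\<in>{2..s}.
      (\<forall>p\<in>{1..sF}. Y (FastStage i p) = Y (Slow (i - 1)) + H *\<^sub>R I i (AF p)) \<and>
      Y (Slow i) = Y (Slow (i - 1)) + H *\<^sub>R I i bF) \<and> y1 = Y (Slow s)"
    unfolding imex_mri_gark_step_def I_def by (simp only: mri_fast_rhs_eq cong: ball_cong)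
  have gark: "?gark \<longleftrightarrow> (\<forall>z\<in>S. Y z = y0 + H *\<^sub>R T z) \<and> y1 = y0 + H *\<^sub>R T (Slow s)"
    unfolding gark_step_def T_def ..
  have S_slow: "Slow i \<in> S \<longleftrightarrow> i \<in> {1..s}" and S_fast: "FastStage i p \<in> S \<longleftrightarrow> i \<in> {2..s} \<and> p \<in> {1..sF}" for i p
    by (auto simp: mri_stages_def)
  show ?thesis
    unfolding mri gark
  proof
    assume *: "Y (Slow 1) = y0 \<and> (\<forall>i\<in>{2..s}.
      (\<forall>p\<in>{1..sF}. Y (FastStage i p) = Y (Slow (i - 1)) + H *\<^sub>R I i (AF p)) \<and>
      Y (Slow i) = Y (Slow (i - 1)) + H *\<^sub>R I i bF) \<and> y1 = Y (Slow s)"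
    have slow: "Y (Slow i) = y0 + H *\<^sub>R T (Slow i)" if "1 \<le> i" "i \<le> s" for i
      using that
    proof (induction i rule: dec_induct)
      case base
      then show ?case using * T_1 by simp
    next
      case (step n)
      then have "Suc n \<in> {2..s}" by auto
      with * T_step[OF this] step show ?case by (simp add: scaleR_add_right)
    qed
    have "Y z = y0 + H *\<^sub>R T z" if z: "z \<in> S" for z
    proof (cases z)
      case (Slow i)
      then show ?thesis using z slow S_slow by auto
    next
      case (FastStage i p)
      with z S_fast have ip: "i \<in> {2..s}" "p \<in> {1..sF}" by auto
      then have "Y z = Y (Slow (i - 1)) + H *\<^sub>R I i (AF p)" using * FastStage by blast
      also have "Y (Slow (i - 1)) = y0 + H *\<^sub>R T (Slow (i - 1))" using ip by (intro slow) auto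
      finally show ?thesis by (simp add: FastStage T_fast scaleR_add_right)
    qed
    then show "(\<forall>z\<in>S. Y z = y0 + H *\<^sub>R T z) \<and> y1 = y0 + H *\<^sub>R T (Slow s)"
      using * slow s by auto
  next
    assume *: "(\<forall>z\<in>S. Y z = y0 + H *\<^sub>R T z) \<and> y1 = y0 + H *\<^sub>R T (Slow s)"
    then have slow: "Y (Slow i) = y0 + H *\<^sub>R T (Slow i)" if "i \<in> {1..s}" for i
      using that S_slow by blast
    have "Y (FastStage i p) = Y (Slow (i - 1)) + H *\<^sub>R I i (AF p)" if "i \<in> {2..s}" "p \<in> {1..sF}" for i p
    proof -
      have "Y (FastStage i p) = y0 + H *\<^sub>R T (FastStage i p)" using * that S_fast by blast
      moreover have "i - 1 \<in> {1..s}" using that by auto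
      ultimately show ?thesis using slow[of "i - 1"] by (simp add: T_fast scaleR_add_right)
    qed
    moreover have "Y (Slow i) = Y (Slow (i - 1)) + H *\<^sub>R I i bF" if "i \<in> {2..s}" for i
    proof -
      have "i \<in> {1..s}" "i - 1 \<in> {1..s}" using that by auto
      then show ?thesis using slow T_step[OF that] by (simp add: scaleR_add_right)
    qed
    moreover have "Y (Slow 1) = y0" using slow[of 1] s T_1 by simp
    moreover have "y1 = Y (Slow s)" using slow[of s] * s by simp
    ultimately show "Y (Slow 1) = y0 \<and> (\<forall>i\<in>{2..s}.
      (\<forall>p\<in>{1..sF}. Y (FastStage i p) = Y (Slow (i - 1)) + H *\<^sub>R I i (AF p)) \<and>
      Y (Slow i) = Y (Slow (i - 1)) + H *\<^sub>R I i bF) \<and> y1 = Y (Slow s)"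
      by blast
  qed
qed

section \<open>Row sums and slow coefficients\<close>

lemma coeff_poly_row_sum:
  assumes "i \<in> {1..s}"
  shows "(\<Sum>j=1..s. coeff_poly kmax (G \<sigma>) i j \<tau>) = \<Delta>c i"
proof -
  have "(\<Sum>j=1..s. coeff_poly kmax (G \<sigma>) i j \<tau>) = (\<Sum>k=0..kmax. mat_vec s (G \<sigma> k) (\<lambda>_. 1) i * \<tau> ^ k)"
    unfolding coeff_poly_def mat_vec_def sum_distrib_right by (subst sum.swap) simp
  \<comment> \<open>Internal consistency removes all powers \<open>\<tau> ^ k\<close> with
    \<open>k \<ge> 1\<close>, so each slow forcing has the same constant total
    \<open>\<Delta>c i\<close> as the fast one.\<close>
  also have "\<dots> = (\<Sum>k=0..kmax. if k = 0 then \<Delta>c i else 0)"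
    using assms G_0_sum G_sum by (intro sum.cong) auto
  finally show ?thesis by simp
qed

lemma incr_row_sum:
  assumes "i \<in> {2..s}"
  shows "(\<Sum>x\<in>S. incr \<sigma> i w x) = \<Delta>c i * (\<Sum>l=1..sF. w l)"
proof (cases "\<sigma> = Fast")
  case True
  then show ?thesis
    using sum_incr_fast[OF assms, of w "\<lambda>_. 1 :: real"]
    by (simp add: sum_distrib_left mult.commute)
next
  case False
  have "(\<Sum>x\<in>S. incr \<sigma> i w x) = (\<Sum>l=1..sF. w l * \<Delta>c i)"
    using sum_incr_slow[OF False, of i w "\<lambda>_. 1 :: real"] assms
    by (simp add: coeff_poly_row_sum del: One_nat_def)
  then show ?thesis by (simp add: sum_distrib_left mult.commute)
qed

text \<open>A discrete fundamental theorem of calculus over the slow intervals, used with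
  \<open>c\<close> and with multiples of its square and cube for \<open>g\<close>.\<close>

lemma telescope:
  fixes g :: "nat \<Rightarrow> real"
  assumes "\<And>k. k \<in> {2..s} \<Longrightarrow> \<phi> k = g k - g (k - 1)" "g 1 = 0" "i \<in> {1..s}"
  shows "(\<Sum>k=2..i. \<phi> k) = g i"
proof -
  have "1 \<le> i" "i \<le> s" using assms by auto
  then show ?thesis
  proof (induction i rule: dec_induct)
    case base
    then show ?case using assms by simp
  next
    case (step n)
    then show ?case using assms(1)[of "Suc n"] by simp
  qed
qed

lemma bF_sum: "(\<Sum>l=1..sF. bF l) = 1"
  using bF_quad[of 0] by (simp add: dot_def)

text \<open>The hypothesis under which the general equivalence applies: completed intervals
  telescope to \<open>c\<close>, and a fast stage adds the fraction \<open>cF p\<close> of the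
  current one.\<close>

lemma stage_mat_row_sum:
  assumes "z \<in> S"
  shows "(\<Sum>x\<in>S. stage_mat \<sigma> z x) = node z"
proof -
  have slow: "(\<Sum>x\<in>S. stage_mat \<sigma> (Slow i) x) = c i" if "i \<in> {1..s}" for i
  proof -
    have "(\<Sum>x\<in>S. stage_mat \<sigma> (Slow i) x) = (\<Sum>k=2..i. \<Sum>x\<in>S. incr \<sigma> k bF x)"
      unfolding stage_mat.simps by (rule sum.swap)
    also have "\<dots> = c i"
      by (rule telescope[where g = c, OF _ c_1 that]) (simp add: incr_row_sum bF_sum dc del: One_nat_def)
    finally show ?thesis .
  qed
  show ?thesis
  proof (cases z)
    case (Slow i)
    then show ?thesis using assms slow by (auto simp: mri_stages_def)
  next
    case (FastStage i p)
    then have ip: "i \<in> {2..s}" "p \<in> {1..sF}" using assms by (auto simp: mri_stages_def)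
    have "(\<Sum>x\<in>S. stage_mat \<sigma> (FastStage i p) x) =
        (\<Sum>x\<in>S. stage_mat \<sigma> (Slow (i - 1)) x) + (\<Sum>x\<in>S. incr \<sigma> i (AF p) x)"
      by (simp add: sum.distrib)
    also have "(\<Sum>x\<in>S. stage_mat \<sigma> (Slow (i - 1)) x) = c (i - 1)" using ip by (intro slow) auto
    also have "(\<Sum>x\<in>S. incr \<sigma> i (AF p) x) = \<Delta>c i * cF p"
      using AF_sum[OF ip(2)] by (simp add: incr_row_sum[OF ip(1)] mat_vec_def)
    finally show ?thesis by (simp add: FastStage mult.commute)
  qed
qed

text \<open>Exactness of \<open>bF\<close> on monomials turns each coefficient polynomial into its
  mean over [0, 1], an entry of \<open>bar_mat\<close>; accumulating the intervals is multiplication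
  by \<open>E_mat\<close>.\<close>

lemma stage_mat_base:
  assumes "\<sigma> \<noteq> Fast" "i \<in> {1..s}" "j \<in> {1..s}"
  shows "stage_mat \<sigma> (Slow i) (Slow j) = base \<sigma> i j"
proof -
  have bar: "incr \<sigma> k bF (Slow j) = bar_mat kmax (G \<sigma>) k j" for k
  proof -
    have "incr \<sigma> k bF (Slow j) = (\<Sum>l=1..sF. \<Sum>m=0..kmax. G \<sigma> m k j * (bF l * cF l ^ m))"
      using assms(1) by (simp add: incr_def coeff_poly_def sum_distrib_left mult_ac)
    also have "\<dots> = (\<Sum>m=0..kmax. G \<sigma> m k j * dot sF bF (\<lambda>l. cF l ^ m))"
      unfolding dot_def sum_distrib_left by (rule sum.swap)
    also have "\<dots> = bar_mat kmax (G \<sigma>) k j"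
      unfolding bar_mat_def by (intro sum.cong) (auto simp: bF_quad)
    finally show ?thesis .
  qed
  \<comment> \<open>The accumulated increments start at index 2, multiplication by
    \<open>E_mat\<close> at 1; the zero first row closes the gap.\<close>
  have bar_1: "bar_mat kmax (G \<sigma>) 1 j = 0"
    unfolding bar_mat_def using assms by (intro sum.neutral) (auto simp: G_1 simp del: One_nat_def)
  have "base \<sigma> i j = (\<Sum>k=1..s. if k \<le> i then bar_mat kmax (G \<sigma>) k j else 0)"
    unfolding base_mat_def mat_mult_def by (intro sum.cong) (auto simp: E_mat_def)
  also have "\<dots> = (\<Sum>k=1..i. bar_mat kmax (G \<sigma>) k j)"
    using assms by (intro sum.mono_neutral_cong_right) auto
  also have "\<dots> = bar_mat kmax (G \<sigma>) 1 j + (\<Sum>k=2..i. bar_mat kmax (G \<sigma>) k j)"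
    using assms by (subst sum.atLeast_Suc_atMost) (auto simp: numeral_2_eq_2)
  finally show ?thesis by (simp add: bar bar_1 del: One_nat_def)
qed

lemma sum_stage_mat_slow:
  assumes "\<sigma> \<noteq> Fast" "i \<in> {1..s}"
  shows "(\<Sum>x\<in>S. stage_mat \<sigma> (Slow i) x * \<phi> x) = (\<Sum>j=1..s. base \<sigma> i j * \<phi> (Slow j))"
proof -
  have "stage_mat \<sigma> (Slow i) (FastStage k l) = 0" for k l
    using assms by (simp add: incr_def)
  then show ?thesis
    using assms by (simp add: sum_mri_stages stage_mat_base del: stage_mat.simps)
qed

lemma sum_stage_mat_fast:
  assumes "i \<in> {1..s}"
  shows "(\<Sum>x\<in>S. stage_mat Fast (Slow i) x * \<phi> x) = (\<Sum>k=2..i. \<Delta>c k * (\<Sum>l=1..sF. bF l * \<phi> (FastStage k l)))"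
proof -
  have "(\<Sum>x\<in>S. stage_mat Fast (Slow i) x * \<phi> x) = (\<Sum>k=2..i. \<Sum>x\<in>S. incr Fast k bF x * \<phi> x)"
    using sum_stage_mat_Slow[of Fast i \<phi>] by simp
  also have "\<dots> = (\<Sum>k=2..i. \<Delta>c k * (\<Sum>l=1..sF. bF l * \<phi> (FastStage k l)))"
  proof (rule sum.cong)
    fix k assume "k \<in> {2..i}"
    then have "k \<in> {2..s}" using assms by auto
    from sum_incr_fast[OF this, of bF \<phi>]
    show "(\<Sum>x\<in>S. incr Fast k bF x * \<phi> x) = \<Delta>c k * (\<Sum>l=1..sF. bF l * \<phi> (FastStage k l))"
      by (simp add: sum_distrib_left mult_ac)
  qed simp
  finally show ?thesis .
qed

text \<open>For \<open>w = AF p\<close>, weighting the inner sums with \<open>bF p\<close> later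
  produces the numbers \<open>zeta\<close>.\<close>

lemma incr_slow_node:
  assumes "\<sigma> \<noteq> Fast"
  shows "(\<Sum>x\<in>S. incr \<sigma> i w x * node x) =
    (\<Sum>k=0..kmax. (\<Sum>l=1..sF. w l * cF l ^ k) * mat_vec s (G \<sigma> k) c i)"
proof -
  have "(\<Sum>x\<in>S. incr \<sigma> i w x * node x) =
      (\<Sum>l=1..sF. w l * (\<Sum>j=1..s. \<Sum>k=0..kmax. cF l ^ k * (G \<sigma> k i j * c j)))"
    using sum_incr_slow[OF assms, of i w node]
    by (simp add: coeff_poly_def sum_distrib_right sum_distrib_left mult_ac)
  also have "\<dots> = (\<Sum>l=1..sF. \<Sum>k=0..kmax. w l * cF l ^ k * mat_vec s (G \<sigma> k) c i)"
    by (subst sum.swap) (simp add: mat_vec_def sum_distrib_left mult_ac)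
  also have "\<dots> = (\<Sum>k=0..kmax. (\<Sum>l=1..sF. w l * cF l ^ k) * mat_vec s (G \<sigma> k) c i)"
    by (subst sum.swap) (simp add: sum_distrib_right)
  finally show ?thesis .
qed

section \<open>The order conditions of the fully discrete scheme\<close>

context
  assumes fast: "gark_order_conditions {Fast} {1..sF} (\<lambda>_. AF) (\<lambda>_. bF) cF"
begin

lemma bF_conditions:
  "(\<Sum>l=1..sF. bF l * cF l) = 1/2" "(\<Sum>l=1..sF. bF l * (cF l)\<^sup>2) = 1/3"
  "(\<Sum>p=1..sF. bF p * (\<Sum>l=1..sF. AF p l * cF l)) = 1/6"
  using fast by (auto simp: gark_order_conditions_def)

text \<open>A composite quadrature for the integral of \<open>x\<close> over
  \<open>[0, c i]\<close>: interval \<open>k\<close> runs from \<open>c (k - 1)\<close> to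
  \<open>c k\<close>, and the first moments of \<open>bF\<close> make it exact there.\<close>

lemma stage_mat_fast_node:
  assumes i: "i \<in> {1..s}"
  shows "(\<Sum>x\<in>S. stage_mat Fast (Slow i) x * node x) = (c i)\<^sup>2 / 2"
  unfolding sum_stage_mat_fast[OF i]
proof (rule telescope[OF _ _ i])
  fix k assume k: "k \<in> {2..s}"
  have eq: "(\<Sum>l=1..sF. bF l * node (FastStage k l)) =
      c (k - 1) * (\<Sum>l=1..sF. bF l) + \<Delta>c k * (\<Sum>l=1..sF. bF l * cF l)"
    by (simp add: sum_distrib_left sum.distrib algebra_simps)
  show "\<Delta>c k * (\<Sum>l=1..sF. bF l * node (FastStage k l)) = (c k)\<^sup>2 / 2 - (c (k - 1))\<^sup>2 / 2"
    unfolding eq bF_sum bF_conditions dc[OF k] by (simp add: power2_eq_square field_simps)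
qed (use c_1 in simp)

lemma stage_mat_fast_node_sq:
  assumes i: "i \<in> {1..s}"
  shows "(\<Sum>x\<in>S. stage_mat Fast (Slow i) x * (node x)\<^sup>2) = (c i) ^ 3 / 3"
  unfolding sum_stage_mat_fast[OF i]
proof (rule telescope[OF _ _ i])
  fix k assume k: "k \<in> {2..s}"
  have eq: "(\<Sum>l=1..sF. bF l * (node (FastStage k l))\<^sup>2) =
      (c (k - 1))\<^sup>2 * (\<Sum>l=1..sF. bF l) + 2 * c (k - 1) * \<Delta>c k * (\<Sum>l=1..sF. bF l * cF l)
       + (\<Delta>c k)\<^sup>2 * (\<Sum>l=1..sF. bF l * (cF l)\<^sup>2)"
    by (simp add: sum_distrib_left sum.distrib power2_eq_square algebra_simps)
  show "\<Delta>c k * (\<Sum>l=1..sF. bF l * (node (FastStage k l))\<^sup>2) = (c k) ^ 3 / 3 - (c (k - 1)) ^ 3 / 3"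
    unfolding eq bF_sum bF_conditions dc[OF k] by (simp add: power2_eq_square power3_eq_cube field_simps)
qed (use c_1 in simp)

text \<open>The iterated integral. The inner sums at fast stages need not be exact integrals, but
  once they are weighted with \<open>bF\<close>, the condition \<open>b A c = 1/6\<close> of the
  fast method restores the integral of \<open>x^2 / 2\<close> over each interval.\<close>

lemma stage_mat_fast_fast_node:
  assumes i: "i \<in> {1..s}"
  shows "(\<Sum>z\<in>S. stage_mat Fast (Slow i) z * (\<Sum>x\<in>S. stage_mat Fast z x * node x)) = (c i) ^ 3 / 6"
  unfolding sum_stage_mat_fast[OF i]
proof (rule telescope[OF _ _ i])
  fix k assume k: "k \<in> {2..s}"
  then have k1: "k - 1 \<in> {1..s}" by auto
  have "(\<Sum>x\<in>S. stage_mat Fast (FastStage k p) x * node x) =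
      (c (k - 1))\<^sup>2 / 2 + \<Delta>c k * (c (k - 1) * cF p + \<Delta>c k * (\<Sum>l=1..sF. AF p l * cF l))"
    if "p \<in> {1..sF}" for p
  proof -
    have "(\<Sum>x\<in>S. incr Fast k (AF p) x * node x) = \<Delta>c k * (\<Sum>l=1..sF. AF p l * (c (k - 1) + cF l * \<Delta>c k))"
      using sum_incr_fast[OF k, of "AF p" node] by (simp add: sum_distrib_left mult_ac)
    also have "(\<Sum>l=1..sF. AF p l * (c (k - 1) + cF l * \<Delta>c k)) = c (k - 1) * cF p + \<Delta>c k * (\<Sum>l=1..sF. AF p l * cF l)"
      using AF_sum[OF that, symmetric]
      by (simp add: mat_vec_def sum_distrib_left sum.distrib algebra_simps)
    finally show ?thesis
      using sum_stage_mat_FastStage[of Fast k p node] stage_mat_fast_node[OF k1]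
      by (simp del: stage_mat.simps)
  qed
  then have "(\<Sum>p=1..sF. bF p * (\<Sum>x\<in>S. stage_mat Fast (FastStage k p) x * node x)) =
      (\<Sum>p=1..sF. bF p * ((c (k - 1))\<^sup>2 / 2 + \<Delta>c k * (c (k - 1) * cF p + \<Delta>c k * (\<Sum>l=1..sF. AF p l * cF l))))"
    by simp
  also have "\<dots> = (c (k - 1))\<^sup>2 / 2 * (\<Sum>p=1..sF. bF p) + \<Delta>c k * c (k - 1) * (\<Sum>p=1..sF. bF p * cF p)
      + (\<Delta>c k)\<^sup>2 * (\<Sum>p=1..sF. bF p * (\<Sum>l=1..sF. AF p l * cF l))"
    unfolding sum_distrib_left[of "(c (k - 1))\<^sup>2 / 2"] sum_distrib_left[of "\<Delta>c k * c (k - 1)"]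
      sum_distrib_left[of "(\<Delta>c k)\<^sup>2"] sum.distrib[symmetric]
    by (intro sum.cong) (simp_all add: power2_eq_square algebra_simps)
  finally have eq: "(\<Sum>p=1..sF. bF p * (\<Sum>x\<in>S. stage_mat Fast (FastStage k p) x * node x)) = \<dots>" .
  show "\<Delta>c k * (\<Sum>p=1..sF. bF p * (\<Sum>x\<in>S. stage_mat Fast (FastStage k p) x * node x)) =
      (c k) ^ 3 / 6 - (c (k - 1)) ^ 3 / 6"
    unfolding eq bF_sum bF_conditions dc[OF k]
    by (simp add: power2_eq_square power3_eq_cube field_simps)
qed (use c_1 in simp)

text \<open>Origin of the coupling matrix: every fast stage of interval \<open>k\<close> inherits
  the coefficients of slow stage \<open>k - 1\<close>, with total weight 1, which is
  \<open>L_mat\<close> times the base matrix; the slow forcing inside the interval passes through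
  \<open>AF\<close> and then \<open>bF\<close>, which yields \<open>zeta\<close>.\<close>

lemma stage_mat_fast_slow_node:
  assumes "\<sigma> \<noteq> Fast"
  shows "(\<Sum>z\<in>S. stage_mat Fast (Slow s) z * (\<Sum>x\<in>S. stage_mat \<sigma> z x * node x)) =
    dot s \<Delta>c (mat_vec s (coupling_mat s kmax (G \<sigma>) sF AF bF cF) c)"
proof -
  have ss: "s \<in> {1..s}" using s by simp
  have "\<Delta>c k * (\<Sum>p=1..sF. bF p * (\<Sum>x\<in>S. stage_mat \<sigma> (FastStage k p) x * node x)) =
      \<Delta>c k * mat_vec s (coupling_mat s kmax (G \<sigma>) sF AF bF cF) c k" if k: "k \<in> {2..s}" for k
  proof -
    have k1: "k - 1 \<in> {1..s}" using k by auto
    have L: "mat_mult s L_mat (base \<sigma>) k j = base \<sigma> (k - 1) j" for j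
    proof -
      have "mat_mult s L_mat (base \<sigma>) k j = (\<Sum>m=1..s. if m = k - 1 then base \<sigma> (k - 1) j else 0)"
        unfolding mat_mult_def using k by (intro sum.cong) (auto simp: L_mat_def)
      then show ?thesis using k1 by simp
    qed
    define B where "B = (\<Sum>j=1..s. base \<sigma> (k - 1) j * c j)"
    have "(\<Sum>x\<in>S. stage_mat \<sigma> (FastStage k p) x * node x) = B
        + (\<Sum>m=0..kmax. (\<Sum>l=1..sF. AF p l * cF l ^ m) * mat_vec s (G \<sigma> m) c k)" for p
      using sum_stage_mat_FastStage[of \<sigma> k p node] sum_stage_mat_slow[OF assms k1, of node]
        incr_slow_node[OF assms, of k "AF p"] by (simp add: B_def del: stage_mat.simps)
    then have "(\<Sum>p=1..sF. bF p * (\<Sum>x\<in>S. stage_mat \<sigma> (FastStage k p) x * node x)) =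
        (\<Sum>p=1..sF. bF p) * B
        + (\<Sum>p=1..sF. \<Sum>m=0..kmax. bF p * (\<Sum>l=1..sF. AF p l * cF l ^ m) * mat_vec s (G \<sigma> m) c k)"
      by (simp add: distrib_left sum.distrib sum_distrib_left sum_distrib_right[of bF] mult_ac
          del: stage_mat.simps)
    also have "(\<Sum>p=1..sF. \<Sum>m=0..kmax. bF p * (\<Sum>l=1..sF. AF p l * cF l ^ m) * mat_vec s (G \<sigma> m) c k)
        = (\<Sum>m=0..kmax. zeta sF AF bF cF m * mat_vec s (G \<sigma> m) c k)"
      by (subst sum.swap) (simp add: zeta_def dot_def mat_vec_def sum_distrib_right)
    also have "\<dots> = (\<Sum>j=1..s. (\<Sum>m=0..kmax. zeta sF AF bF cF m * G \<sigma> m k j) * c j)"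
      unfolding mat_vec_def sum_distrib_left sum_distrib_right by (subst sum.swap) (simp add: mult_ac)
    finally have "(\<Sum>p=1..sF. bF p * (\<Sum>x\<in>S. stage_mat \<sigma> (FastStage k p) x * node x)) =
        mat_vec s (coupling_mat s kmax (G \<sigma>) sF AF bF cF) c k"
      unfolding bF_sum by (simp add: B_def mat_vec_def coupling_mat_def L sum.distrib distrib_right)
    then show ?thesis by (simp del: stage_mat.simps)
  qed
  then have "(\<Sum>z\<in>S. stage_mat Fast (Slow s) z * (\<Sum>x\<in>S. stage_mat \<sigma> z x * node x)) =
      (\<Sum>k=2..s. \<Delta>c k * mat_vec s (coupling_mat s kmax (G \<sigma>) sF AF bF cF) c k)"
    unfolding sum_stage_mat_fast[OF ss] by (intro sum.cong) auto
  \<comment> \<open>The term for \<open>k = 1\<close> can be added because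
    \<open>\<Delta>c 1 = 0\<close>.\<close>
  also have "\<dots> = dot s \<Delta>c (mat_vec s (coupling_mat s kmax (G \<sigma>) sF AF bF cF) c)"
    unfolding dot_def using s by (subst sum.atLeast_Suc_atMost[of 1]) (use dc_1 in \<open>auto simp: numeral_2_eq_2\<close>)
  finally show ?thesis .
qed

lemma mri_conditions_iff:
  "gark_order_conditions {Impl, Expl, Fast} S stage_mat (\<lambda>\<sigma>. stage_mat \<sigma> (Slow s)) node \<longleftrightarrow>
    gark_order_conditions {Impl, Expl} {1..s} base (\<lambda>\<sigma>. base \<sigma> s) c \<and>
    (\<forall>\<sigma>\<in>{Impl, Expl}. dot s \<Delta>c (mat_vec s (coupling_mat s kmax (G \<sigma>) sF AF bF cF) c) = 1/6)"
proof -
  have ss: "s \<in> {1..s}" using s by simp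
  then have sS: "Slow s \<in> S" by (auto simp: mri_stages_def)
  have slow: "\<sigma> \<noteq> Fast \<Longrightarrow> (\<Sum>x\<in>S. stage_mat \<sigma> (Slow s) x) = (\<Sum>j=1..s. base \<sigma> s j)"
    "\<sigma> \<noteq> Fast \<Longrightarrow> (\<Sum>x\<in>S. stage_mat \<sigma> (Slow s) x * node x) = (\<Sum>j=1..s. base \<sigma> s j * c j)"
    "\<sigma> \<noteq> Fast \<Longrightarrow> (\<Sum>x\<in>S. stage_mat \<sigma> (Slow s) x * (node x)\<^sup>2) = (\<Sum>j=1..s. base \<sigma> s j * (c j)\<^sup>2)" for \<sigma>
    using sum_stage_mat_slow[OF _ ss, of \<sigma> "\<lambda>_. 1"] by (simp_all add: sum_stage_mat_slow[OF _ ss] del: stage_mat.simps)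
  have slow_slow: "(\<Sum>z\<in>S. stage_mat \<sigma> (Slow s) z * (\<Sum>x\<in>S. stage_mat \<tau> z x * node x)) =
      (\<Sum>i=1..s. base \<sigma> s i * (\<Sum>j=1..s. base \<tau> i j * c j))" if "\<sigma> \<noteq> Fast" "\<tau> \<noteq> Fast" for \<sigma> \<tau>
    unfolding sum_stage_mat_slow[OF that(1) ss]
    by (intro sum.cong refl) (simp add: sum_stage_mat_slow[OF that(2)] del: stage_mat.simps)
  have slow_fast: "(\<Sum>z\<in>S. stage_mat \<sigma> (Slow s) z * (\<Sum>x\<in>S. stage_mat Fast z x * node x)) =
      (\<Sum>i=1..s. base \<sigma> s i * (c i)\<^sup>2) / 2" if "\<sigma> \<noteq> Fast" for \<sigma>
    unfolding sum_stage_mat_slow[OF that ss] sum_divide_distrib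
    by (intro sum.cong refl) (simp add: stage_mat_fast_node del: stage_mat.simps)
  \<comment> \<open>\<open>T\<close> is the range of the inner component, so that the effect of
    adding \<open>Fast\<close> to it can be examined separately.\<close>
  define conds where "conds T \<sigma> \<longleftrightarrow> (\<Sum>x\<in>S. stage_mat \<sigma> (Slow s) x) = 1 \<and>
      (\<Sum>x\<in>S. stage_mat \<sigma> (Slow s) x * node x) = 1/2 \<and>
      (\<Sum>x\<in>S. stage_mat \<sigma> (Slow s) x * (node x)\<^sup>2) = 1/3 \<and>
      (\<forall>\<tau>\<in>T. (\<Sum>z\<in>S. stage_mat \<sigma> (Slow s) z * (\<Sum>x\<in>S. stage_mat \<tau> z x * node x)) = 1/6)" for T \<sigma>
  have mri: "gark_order_conditions {Impl, Expl, Fast} S stage_mat (\<lambda>\<sigma>. stage_mat \<sigma> (Slow s)) node \<longleftrightarrow>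
      (\<forall>\<sigma>\<in>{Impl, Expl, Fast}. conds {Impl, Expl, Fast} \<sigma>)"
    unfolding gark_order_conditions_def conds_def ..
  have base: "gark_order_conditions {Impl, Expl} {1..s} base (\<lambda>\<sigma>. base \<sigma> s) c \<longleftrightarrow>
      (\<forall>\<sigma>\<in>{Impl, Expl}. conds {Impl, Expl} \<sigma>)"
    unfolding gark_order_conditions_def conds_def
    by (simp add: slow slow_slow del: stage_mat.simps One_nat_def)
  \<comment> \<open>A slow-fast condition is half of the quadrature condition with value 1/3, so it
    adds nothing.\<close>
  have conds_slow: "conds {Impl, Expl, Fast} \<sigma> \<longleftrightarrow> conds {Impl, Expl} \<sigma>" if "\<sigma> \<noteq> Fast" for \<sigma>
    unfolding conds_def using slow_fast[OF that] slow(3)[OF that] by auto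
  \<comment> \<open>The weights of \<open>Impl\<close> sum to 1 by the first condition and to
    \<open>c s\<close> by internal consistency.\<close>
  have c_s: "c s = 1" if "conds {Impl, Expl} Impl"
    using that stage_mat_row_sum[OF sS, of Impl] by (simp add: conds_def del: stage_mat.simps)
  \<comment> \<open>At \<open>c s = 1\<close> the purely fast sums are 1, 1/2, 1/3 and 1/6; the
    conditions left over have a slow inner component.\<close>
  have conds_fast: "conds {Impl, Expl, Fast} Fast \<longleftrightarrow>
      (\<forall>\<sigma>\<in>{Impl, Expl}. dot s \<Delta>c (mat_vec s (coupling_mat s kmax (G \<sigma>) sF AF bF cF) c) = 1/6)"
    if "c s = 1"
    unfolding conds_def
    by (simp add: stage_mat_row_sum[OF sS] stage_mat_fast_node[OF ss] stage_mat_fast_node_sq[OF ss]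
        stage_mat_fast_fast_node[OF ss] stage_mat_fast_slow_node that del: stage_mat.simps One_nat_def)
  show ?thesis
    unfolding mri base using conds_slow[of Impl] conds_slow[of Expl] c_s conds_fast by blast
qed

end

theorem imex_mri_gark_order_3_iff:
  assumes "rk_order sF AF bF cF 3 TYPE('a::euclidean_space)"
  shows "imex_mri_gark_order s c \<Delta>c kmax (G Impl) (G Expl) sF AF bF cF 3 TYPE('a) \<longleftrightarrow>
    imex_ark_order s (base Impl) (base Expl) c 3 TYPE('a) \<and>
    (\<forall>\<sigma>\<in>{Impl, Expl}. dot s \<Delta>c (mat_vec s (coupling_mat s kmax (G \<sigma>) sF AF bF cF) c) = 1/6)"
proof -
  have fast: "gark_order_conditions {Fast} {1..sF} (\<lambda>_. AF) (\<lambda>_. bF) cF"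
    using assms AF_sum rk_order_3_iff[where 'a = 'a] by blast
  have "imex_mri_gark_step s c \<Delta>c kmax (G Impl) (G Expl) sF AF bF cF =
      (gark_step {Impl, Expl, Fast} S stage_mat (\<lambda>\<sigma>. stage_mat \<sigma> (Slow s)) node ::
        (component \<Rightarrow> real \<Rightarrow> 'a \<Rightarrow> 'a) \<Rightarrow> _)"
    by (intro ext imex_mri_gark_step_eq)
  then have "imex_mri_gark_order s c \<Delta>c kmax (G Impl) (G Expl) sF AF bF cF 3 TYPE('a) \<longleftrightarrow>
      gark_order_conditions {Impl, Expl, Fast} S stage_mat (\<lambda>\<sigma>. stage_mat \<sigma> (Slow s)) node"
    unfolding imex_mri_gark_order_def
    by (simp only:) (intro gark_order_3_iff finite_component_set finite_mri_stages stage_mat_row_sum)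
  also have "\<dots> \<longleftrightarrow> gark_order_conditions {Impl, Expl} {1..s} base (\<lambda>\<sigma>. base \<sigma> s) c \<and>
    (\<forall>\<sigma>\<in>{Impl, Expl}. dot s \<Delta>c (mat_vec s (coupling_mat s kmax (G \<sigma>) sF AF bF cF) c) = 1/6)"
    by (rule mri_conditions_iff[OF fast])
  also have "gark_order_conditions {Impl, Expl} {1..s} base (\<lambda>\<sigma>. base \<sigma> s) c \<longleftrightarrow>
      imex_ark_order s (base Impl) (base Expl) c 3 TYPE('a)"
    by (rule imex_ark_order_3_iff[OF s, symmetric]) (auto intro: base_sum)
  finally show ?thesis .
qed

end

theorem theorem2p3:
  fixes s kmax sF :: nat
    and c \<Delta>c :: "nat \<Rightarrow> real"
    and \<Gamma> \<Omega> :: "nat \<Rightarrow> nat \<Rightarrow> nat \<Rightarrow> real"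
    and AF :: "nat \<Rightarrow> nat \<Rightarrow> real"
    and bF cF :: "nat \<Rightarrow> real"
  assumes "s \<ge> 1"
    and "c 1 = 0"
    and "\<Delta>c 1 = 0"
    and "\<And>i. i \<in> {2..s} \<Longrightarrow> \<Delta>c i = c i - c (i - 1)"
    and "\<And>i. i \<in> {2..s} \<Longrightarrow> \<Delta>c i \<ge> 0"
    and "\<And>k i j. k \<le> kmax \<Longrightarrow> i \<in> {1..s} \<Longrightarrow> j \<in> {1..s} \<Longrightarrow> i < j \<Longrightarrow> \<Gamma> k i j = 0"
    and "\<And>k i j. k \<le> kmax \<Longrightarrow> i \<in> {1..s} \<Longrightarrow> j \<in> {1..s} \<Longrightarrow> i \<le> j \<Longrightarrow> \<Omega> k i j = 0"
    and "\<And>k j. k \<le> kmax \<Longrightarrow> j \<in> {1..s} \<Longrightarrow> \<Gamma> k 1 j = 0"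
    and "\<And>k j. k \<le> kmax \<Longrightarrow> j \<in> {1..s} \<Longrightarrow> \<Omega> k 1 j = 0"
    (* internal consistency of the IMEX-MRI-GARK method *)
    and "\<And>i. i \<in> {1..s} \<Longrightarrow> mat_vec s (\<Gamma> 0) (\<lambda>_. 1) i = \<Delta>c i"
    and "\<And>i. i \<in> {1..s} \<Longrightarrow> mat_vec s (\<Omega> 0) (\<lambda>_. 1) i = \<Delta>c i"
    and "\<And>k i. k \<in> {1..kmax} \<Longrightarrow> i \<in> {1..s} \<Longrightarrow> mat_vec s (\<Gamma> k) (\<lambda>_. 1) i = 0"
    and "\<And>k i. k \<in> {1..kmax} \<Longrightarrow> i \<in> {1..s} \<Longrightarrow> mat_vec s (\<Omega> k) (\<lambda>_. 1) i = 0"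
    (* internal consistency of the base IMEX-ARK method *)
    and "\<And>i. i \<in> {1..s} \<Longrightarrow> mat_vec s (base_mat s kmax \<Gamma>) (\<lambda>_. 1) i = c i"
    and "\<And>i. i \<in> {1..s} \<Longrightarrow> mat_vec s (base_mat s kmax \<Omega>) (\<lambda>_. 1) i = c i"
    (* the fast Runge-Kutta method *)
    and "\<And>p. p \<in> {1..sF} \<Longrightarrow> mat_vec sF AF (\<lambda>_. 1) p = cF p"
    and "\<And>k. k \<le> kmax \<Longrightarrow> dot sF bF (\<lambda>l. cF l ^ k) = 1 / (real k + 1)"
    and "rk_order sF AF bF cF 3 TYPE('a::euclidean_space)"
  shows "imex_mri_gark_order s c \<Delta>c kmax \<Gamma> \<Omega> sF AF bF cF 3 TYPE('a) \<longleftrightarrow>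
    imex_ark_order s (base_mat s kmax \<Gamma>) (base_mat s kmax \<Omega>) c 3 TYPE('a) \<and>
    dot s \<Delta>c (mat_vec s (coupling_mat s kmax \<Gamma> sF AF bF cF) c) = 1 / 6 \<and>
    dot s \<Delta>c (mat_vec s (coupling_mat s kmax \<Omega> sF AF bF cF) c) = 1 / 6"
proof -
  \<comment> \<open>\<open>Fast\<close> is sent to \<open>\<Omega>\<close> as a default value, so
    that the hypotheses on \<open>G\<close> hold for every component.\<close>
  interpret mri_gark s kmax sF c \<Delta>c "\<lambda>\<sigma>. if \<sigma> = Impl then \<Gamma> else \<Omega>" AF bF cF
  proof (unfold_locales, goal_cases)
    case 1
    show ?case by (rule assms(1))
  next
    case 2
    show ?case by (rule assms(2))
  next
    case 3
    show ?case by (rule assms(3))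
  next
    case (4 i)
    then show ?case by (rule assms(4))
  next
    case (5 \<sigma> k i j)
    then show ?case using assms(6)[of k i j] assms(7)[of k i j] by simp
  next
    case (6 k i)
    then show ?case using assms(7)[of k i i] by simp
  next
    case (7 \<sigma> k j)
    then show ?case using assms(8,9)[of k j] by simp
  next
    case (8 \<sigma> i)
    then show ?case using assms(10,11)[of i] by simp
  next
    case (9 \<sigma> k i)
    then show ?case using assms(12,13)[of k i] by simp
  next
    case (10 \<sigma> i)
    then show ?case using assms(14,15)[of i] by simp
  next
    case (11 p)
    then show ?case by (rule assms(16))
  next
    case (12 k)
    then show ?case by (rule assms(17))
  qed
  show ?thesis using imex_mri_gark_order_3_iff[OF assms(18)] by simp
qed

end
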